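(* Let $d\in\{2,3\}$ and consider a network of $N\ge2$ grains in which each grain has a distinct orientation, with grain boundary surface tensions given by the Read–Shockley model described in the context (model (RS2) if $d=2$; model (RS3) with $\theta_*\le\pi/4$ if $d=3$), and with equal mobilities $\mu_{i,j}=1$ for all $i\ne j$. Let $\alpha>\beta>0$ satisfy $\alpha\ge\max_{i\ne j}\sigma_{i,j}$, $\beta\le\min_{i\ne j}\sigma_{i,j}$, and \[ \alpha\ge\frac{\min_i s_i}{\max_i m_i},\qquad \beta\le\frac{\max_i s_i}{\min_i m_i}, \] where $s_1,\dots,s_{N-1}$, $m_1,\dots,m_{N-1}$ are the eigenvalues on $e^\perp$ of $J\sigma J$ and $J\mathbf{M}J$ respectively, $\mathbf M$ being the matrix with zero diagonal and all off-diagonal entries equal to $1$ (the reciprocal mobility matrix), $e=(1,\dots,1)^T$, $J=I-\frac1Nee^T$. Then for every $\delta t>0$ Algorithm 4 (described in the context) with kernels $K_{i,j}=a_{i,j}G_{\sqrt\alpha}+b_{i,j}G_{\sqrt\beta}$ is unconditionally gradient stable: $E_{\sqrt{\delta t}}(\boldsymbol\Sigma^{k+1},\boldsymbol K)\le E_{\sqrt{\delta t}}(\boldsymbol\Sigma^{k},\boldsymbol K)$ for every $k$ (equivalently for the relaxed energy evaluated at the characteristic functions of the phases).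
   Context: Read–Shockley model in 2D (RS2): grain $i$ has orientation $\theta_i\in(-\pi/4,\pi/4]$ (endpoints of $[-\pi/4,\pi/4]$ identified; distinct orientations means $\theta_i\ne\theta_j$ for $i\ne j$), and $\sigma_{i,j}=\min_{k\in\mathbb Z}f(|\theta_i-\theta_j+k\pi/2|)$, where $f:[0,\infty)\to\mathbb R$ is not identically zero and satisfies: (H1) $f\in C([0,\infty))\cap C^2((0,\infty))$ and $\lim_{\xi\to0^+}\xi^2f'(\xi)=0$; (H2) $f(0)=0$, $f\ge0$; (H3) $f'(\xi)\ge0$ for $\xi>0$; (H4) $f''(\xi)\le0$ for $\xi>0$. Read–Shockley model in 3D (RS3): grain $i$ has orientation $g_i\in SO(3)$; for $g\in SO(3)$ let $\theta(g)\in[0,\pi]$ be its rotation angle, $\mathcal O$ the octahedral group of rotational symmetries of the cube, $\theta_{\mathcal O}(g)=\min_{r\in\mathcal O}\theta(rg)$; distinct orientations means $\theta_{\mathcal O}(g_ig_j^T)>0$ for $i\ne j$; the misorientation is $\theta_{i,j}=\theta_{\mathcal O}(g_ig_j^T)$ and $\sigma_{i,j}=f(\theta_{i,j})$ with $f(\theta)=\frac{\theta}{\theta_*}\left(1-\log\frac{\theta}{\theta_*}\right)$ for $\theta<\theta_*$ and $f(\theta)=1$ for $\theta\ge\theta_*$, $\theta_*>0$ a fixed constant. Domain $D$: a flat torus in $\mathbb R^d$; convolutions periodic. $G_{\sqrt\gamma}(x)=(4\pi\gamma)^{-d/2}\exp(-|x|^2/(4\gamma))$; $K_\epsilon(x)=\epsilon^{-d}K(x/\epsilon)$.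 Coefficients: $a_{i,j}=\frac{\sqrt{\pi}\sqrt{\alpha}}{\alpha-\beta}(\sigma_{i,j}-\beta\mu_{i,j}^{-1})$, $b_{i,j}=\frac{\sqrt{\pi}\sqrt{\beta}}{\alpha-\beta}(-\sigma_{i,j}+\alpha\mu_{i,j}^{-1})$. Algorithm 4: from a partition $\boldsymbol\Sigma^k$ of $D$ compute $\psi_i^k=\sum_{j\ne i}\big(a_{i,j}G_{\sqrt{\alpha\delta t}}*\mathbf 1_{\Sigma^k_j}+b_{i,j}G_{\sqrt{\beta\delta t}}*\mathbf 1_{\Sigma^k_j}\big)$ and set $\Sigma_i^{k+1}=\{x:\psi_i^k(x)<\min_{j\ne i}\psi_j^k(x)\}$ (ties assigned to one minimizing index). Energy: $E_{\sqrt{\delta t}}(\boldsymbol\Sigma,\boldsymbol K)=\frac{1}{\sqrt{\delta t}}\sum_{i\ne j}\int_{\Sigma_j}(K_{i,j})_{\sqrt{\delta t}}*\mathbf 1_{\Sigma_i}\,dx$; relaxed version for $\boldsymbol u\in\mathcal K=\{\boldsymbol u\in L^1(D,[0,1]^N):\sum_iu_i=1\text{ a.e.}\}$: $E_{\sqrt{\delta t}}(\boldsymbol u,\boldsymbol K)=\frac{1}{\sqrt{\delta t}}\sum_{i\ne j}\int_D u_j(K_{i,j})_{\sqrt{\delta t}}*u_i\,dx$. *)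

theory Defs
  imports "HOL-Analysis.Analysis"
begin

definition rs2_admissible :: "(real \<Rightarrow> real) \<Rightarrow> bool" where
  "rs2_admissible f \<longleftrightarrow>
     (\<exists>\<xi>\<ge>0. f \<xi> \<noteq> 0) \<and>
     continuous_on {0..} f \<and>
     (\<exists>f' f''. (\<forall>\<xi>>0. (f has_real_derivative f' \<xi>) (at \<xi>) \<and>
                          (f' has_real_derivative f'' \<xi>) (at \<xi>)) \<and>
               continuous_on {0<..} f'' \<and>
               ((\<lambda>\<xi>. \<xi>\<^sup>2 * f' \<xi>) \<longlongrightarrow> 0) (at_right 0) \<and>
               (\<forall>\<xi>>0. f' \<xi> \<ge> 0) \<and>
               (\<forall>\<xi>>0. f'' \<xi> \<le> 0)) \<and>
     f 0 = 0 \<and> (\<forall>\<xi>\<ge>0. f \<xi> \<ge> 0)"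

definition rs2_orientations :: "('g \<Rightarrow> real) \<Rightarrow> bool" where
  "rs2_orientations \<theta> \<longleftrightarrow> (\<forall>i. -pi/4 < \<theta> i \<and> \<theta> i \<le> pi/4) \<and> inj \<theta>"

definition rs2_sigma :: "(real \<Rightarrow> real) \<Rightarrow> ('g \<Rightarrow> real) \<Rightarrow> 'g \<Rightarrow> 'g \<Rightarrow> real" where
  "rs2_sigma f \<theta> i j = Inf ((\<lambda>k::int. f \<bar>\<theta> i - \<theta> j + real_of_int k * pi / 2\<bar>) ` UNIV)"

definition SO3 :: "(real^3^3) set" where
  "SO3 = {g. rotation_matrix g}"

definition rot_angle :: "real^3^3 \<Rightarrow> real" where
  "rot_angle g = arccos ((trace g - 1) / 2)"

definition octahedral_group :: "(real^3^3) set" where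
  "octahedral_group = {r \<in> SO3. (\<lambda>x. r *v x) ` cbox (vec (-1)) (vec 1) = cbox (vec (-1)) (vec 1)}"

definition theta_O :: "real^3^3 \<Rightarrow> real" where
  "theta_O g = Inf ((\<lambda>r. rot_angle (r ** g)) ` octahedral_group)"

definition rs3_f :: "real \<Rightarrow> real \<Rightarrow> real" where
  "rs3_f \<theta>s \<theta> = (if \<theta> < \<theta>s then \<theta> / \<theta>s * (1 - ln (\<theta> / \<theta>s)) else 1)"

definition rs3_orientations :: "('g \<Rightarrow> real^3^3) \<Rightarrow> bool" where
  "rs3_orientations g \<longleftrightarrow> (\<forall>i. g i \<in> SO3) \<and>
     (\<forall>i j. i \<noteq> j \<longrightarrow> theta_O (g i ** transpose (g j)) > 0)"

definition rs3_sigma :: "real \<Rightarrow> ('g \<Rightarrow> real^3^3) \<Rightarrow> 'g \<Rightarrow> 'g \<Rightarrow> real" where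
  "rs3_sigma \<theta>s g i j = rs3_f \<theta>s (theta_O (g i ** transpose (g j)))"

definition e_vec :: "real^'g" where "e_vec = (\<chi> i. 1)"

definition J_mat :: "real^'g^'g" where
  "J_mat = (\<chi> i j. (if i = j then 1 else 0) - 1 / real CARD('g))"

definition tension_mat :: "('g \<Rightarrow> 'g \<Rightarrow> real) \<Rightarrow> real^'g^'g" where
  "tension_mat \<sigma> = (\<chi> i j. if i = j then 0 else \<sigma> i j)"

definition recip_mob_mat :: "('g \<Rightarrow> 'g \<Rightarrow> real) \<Rightarrow> real^'g^'g" where
  "recip_mob_mat \<mu> = (\<chi> i j. if i = j then 0 else inverse (\<mu> i j))"

definition eigs_perp :: "real^'g^'g \<Rightarrow> real set" where
  "eigs_perp A = {c. \<exists>v. v \<noteq> 0 \<and> v \<bullet> e_vec = 0 \<and> A *v v = c *\<^sub>R v}"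

definition lattice :: "real^'d^'d \<Rightarrow> (real^'d) set" where
  "lattice A = {A *v (\<chi> i. real_of_int (k i)) | k. True}"

definition periodic_set :: "real^'d^'d \<Rightarrow> (real^'d) set \<Rightarrow> bool" where
  "periodic_set A S \<longleftrightarrow> (\<forall>x v. v \<in> lattice A \<longrightarrow> (x \<in> S \<longleftrightarrow> x + v \<in> S))"

definition fund_dom :: "real^'d^'d \<Rightarrow> (real^'d) set" where
  "fund_dom A = (\<lambda>y. A *v y) ` {y. \<forall>i. 0 \<le> y $ i \<and> y $ i < 1}"

definition torus_partition :: "real^'d^'d \<Rightarrow> ('g \<Rightarrow> (real^'d) set) \<Rightarrow> bool" where
  "torus_partition A \<Sigma> \<longleftrightarrow>
     (\<forall>i. \<Sigma> i \<in> sets lebesgue \<and> periodic_set A (\<Sigma> i)) \<and>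
     (\<forall>i j. i \<noteq> j \<longrightarrow> \<Sigma> i \<inter> \<Sigma> j = {}) \<and>
     (\<Union>i. \<Sigma> i) = UNIV"

text \<open>Periodic convolution of a kernel with the indicator of a periodic set.\<close>
definition conv_ind :: "(real^'d \<Rightarrow> real) \<Rightarrow> (real^'d) set \<Rightarrow> real^'d \<Rightarrow> real" where
  "conv_ind K S x = (LINT y|lebesgue. K (x - y) * indicator S y)"

definition gauss :: "real \<Rightarrow> real^'d \<Rightarrow> real" where
  "gauss \<gamma> x = (4 * pi * \<gamma>) powr (- real CARD('d) / 2) * exp (- (norm x)\<^sup>2 / (4 * \<gamma>))"

definition kernel_scale :: "real \<Rightarrow> (real^'d \<Rightarrow> real) \<Rightarrow> real^'d \<Rightarrow> real" where
  "kernel_scale \<epsilon> K x = \<epsilon> powr (- real CARD('d)) * K ((1 / \<epsilon>) *\<^sub>R x)"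

definition a_coef :: "real \<Rightarrow> real \<Rightarrow> real \<Rightarrow> real \<Rightarrow> real" where
  "a_coef \<alpha> \<beta> \<sigma> \<mu> = sqrt pi * sqrt \<alpha> / (\<alpha> - \<beta>) * (\<sigma> - \<beta> * inverse \<mu>)"

definition b_coef :: "real \<Rightarrow> real \<Rightarrow> real \<Rightarrow> real \<Rightarrow> real" where
  "b_coef \<alpha> \<beta> \<sigma> \<mu> = sqrt pi * sqrt \<beta> / (\<alpha> - \<beta>) * (- \<sigma> + \<alpha> * inverse \<mu>)"

definition kernel_K :: "real \<Rightarrow> real \<Rightarrow> ('g \<Rightarrow> 'g \<Rightarrow> real) \<Rightarrow> ('g \<Rightarrow> 'g \<Rightarrow> real)
     \<Rightarrow> 'g \<Rightarrow> 'g \<Rightarrow> real^'d \<Rightarrow> real" where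
  "kernel_K \<alpha> \<beta> \<sigma> \<mu> i j x =
     a_coef \<alpha> \<beta> (\<sigma> i j) (\<mu> i j) * gauss \<alpha> x + b_coef \<alpha> \<beta> (\<sigma> i j) (\<mu> i j) * gauss \<beta> x"

definition psi :: "real \<Rightarrow> real \<Rightarrow> ('g::finite \<Rightarrow> 'g \<Rightarrow> real) \<Rightarrow> ('g \<Rightarrow> 'g \<Rightarrow> real) \<Rightarrow> real
     \<Rightarrow> ('g \<Rightarrow> (real^'d) set) \<Rightarrow> 'g \<Rightarrow> real^'d \<Rightarrow> real" where
  "psi \<alpha> \<beta> \<sigma> \<mu> dt \<Sigma> i x =
     (\<Sum>j\<in>UNIV - {i}.
        a_coef \<alpha> \<beta> (\<sigma> i j) (\<mu> i j) * conv_ind (gauss (\<alpha> * dt)) (\<Sigma> j) x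
      + b_coef \<alpha> \<beta> (\<sigma> i j) (\<mu> i j) * conv_ind (gauss (\<beta> * dt)) (\<Sigma> j) x)"

definition alg4_step :: "real^'d^'d \<Rightarrow> real \<Rightarrow> real \<Rightarrow> ('g::finite \<Rightarrow> 'g \<Rightarrow> real)
     \<Rightarrow> ('g \<Rightarrow> 'g \<Rightarrow> real) \<Rightarrow> real \<Rightarrow> ('g \<Rightarrow> (real^'d) set) \<Rightarrow> ('g \<Rightarrow> (real^'d) set) \<Rightarrow> bool" where
  "alg4_step A \<alpha> \<beta> \<sigma> \<mu> dt \<Sigma> \<Sigma>' \<longleftrightarrow>
     torus_partition A \<Sigma>' \<and>
     (\<forall>i x. x \<in> \<Sigma>' i \<longrightarrow> (\<forall>j. psi \<alpha> \<beta> \<sigma> \<mu> dt \<Sigma> i x \<le> psi \<alpha> \<beta> \<sigma> \<mu> dt \<Sigma> j x))"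

definition energy :: "real^'d^'d \<Rightarrow> real \<Rightarrow> real \<Rightarrow> ('g::finite \<Rightarrow> 'g \<Rightarrow> real)
     \<Rightarrow> ('g \<Rightarrow> 'g \<Rightarrow> real) \<Rightarrow> real \<Rightarrow> ('g \<Rightarrow> (real^'d) set) \<Rightarrow> real" where
  "energy A \<alpha> \<beta> \<sigma> \<mu> dt \<Sigma> =
     1 / sqrt dt * (\<Sum>i\<in>UNIV. \<Sum>j\<in>UNIV - {i}.
        (LINT x|lebesgue. indicator (fund_dom A \<inter> \<Sigma> j) x *
           conv_ind (kernel_scale (sqrt dt) (kernel_K \<alpha> \<beta> \<sigma> \<mu> i j)) (\<Sigma> i) x))"

end

theory Submission
  imports Defs "HOL-Probability.Distributions"
begin

text \<open>
  The energy is a quadratic form in the indicators of the phases, and a thresholding step minimizes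
  its linearization at the current partition. Hence the energy does not increase as soon as the
  quadratic form is nonpositive on differences of two partitions, whose components sum to zero.

  Up to a constant a Gaussian is the self-convolution of the Gaussian of half the variance, so each
  Gaussian part of the form is the integral over a fundamental domain of
  \<open>\<Sum>i\<noteq>j. c i j * w i * w j\<close>, where the smoothed differences \<open>w\<close> still sum to zero.
  For \<open>\<mu> = 1\<close> the reciprocal mobility matrix acts as \<open>-1\<close> on the orthogonal complement of \<open>e\<close>,
  and the eigenvalue bounds on \<open>\<alpha>\<close> and \<open>\<beta>\<close> say precisely that both coefficient
  matrices are negative semidefinite there.
\<close>

subsection \<open>Symmetry of the Read--Shockley tensions\<close>

text \<open>Write \<open>B\<close> for the symmetric bilinear form of the energy, \<open>u\<close>
  and \<open>u'\<close> for the old and the new indicators. Nonpositivity on the difference gives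
  \<open>B u' u' + B u u <= 2 * B u' u\<close>, and minimality gives \<open>B u' u <= B u u\<close>;
  together, \<open>B u' u' <= B u u\<close>. The Read--Shockley model provides
  \<open>\<sigma> i j = \<sigma> j i\<close>, on which both the symmetry of \<open>B\<close> and the
  spectral bounds rest. The analytic obstacle is the mixture of domains. Convolutions run over the
  whole space, the outer integral over one fundamental domain, so moving half of a Gaussian from one
  phase to the other is not a plain use of Fubini. Unfolding over the lattice repairs this. It is
  carried out with \<open>ennreal\<close> integrals, where sums and integrals may be exchanged
  without integrability conditions. Moreover the phases are merely Lebesgue measurable while these
  exchanges are made for Borel functions, so each phase is replaced by a Borel representative that
  is still periodic.\<close>

lemma octahedral_group_transpose:
  assumes "r \<in> octahedral_group"
  shows "transpose r \<in> octahedral_group"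
proof -
  have rot: "orthogonal_matrix r" "det r = 1"
    and im: "(\<lambda>x. r *v x) ` cbox (vec (-1)) (vec 1) = cbox (vec (-1)) (vec 1)"
    using assms by (auto simp: octahedral_group_def SO3_def rotation_matrix_def)
  have inv: "transpose r *v (r *v x) = x" for x
    using rot by (simp add: matrix_vector_mul_assoc orthogonal_matrix)
  have "(\<lambda>x. transpose r *v x) ` cbox (vec (-1)) (vec 1)
      = (\<lambda>x. transpose r *v x) ` (\<lambda>x. r *v x) ` cbox (vec (-1)) (vec 1)"
    by (simp only: im)
  also have "\<dots> = cbox (vec (-1)) (vec 1)"
    by (simp only: image_image inv image_ident)
  finally show ?thesis
    using rot by (simp add: octahedral_group_def SO3_def rotation_matrix_def det_transpose
        orthogonal_matrix_transpose)
qed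

lemma trace_transpose: "trace (transpose M) = trace M"
  by (simp add: trace_def transpose_def)

text \<open>The angle depends on the trace alone, which is unchanged by transposing and by cyclic
  permutation, so \<open>r\<close> with \<open>transpose g\<close> gives the same angle as
  \<open>transpose r\<close> with \<open>g\<close>. Transposition preserves the group; hence the two
  infima run over the same set of angles.\<close>

lemma theta_O_transpose: "theta_O (transpose g) = theta_O g"
proof -
  have le: "(\<lambda>r. rot_angle (r ** transpose g)) ` octahedral_group
      \<subseteq> (\<lambda>r. rot_angle (r ** g)) ` octahedral_group" for g
  proof (rule image_subsetI)
    fix r assume r: "r \<in> octahedral_group"
    have "trace (r ** transpose g) = trace (transpose (r ** transpose g))"
      by (simp add: trace_transpose)
    also have "\<dots> = trace (transpose r ** g)"
      unfolding matrix_transpose_mul transpose_transpose by (rule trace_mul_sym)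
    finally have "rot_angle (r ** transpose g) = rot_angle (transpose r ** g)"
      by (simp add: rot_angle_def)
    then show "rot_angle (r ** transpose g) \<in> (\<lambda>r. rot_angle (r ** g)) ` octahedral_group"
      using octahedral_group_transpose[OF r] by blast
  qed
  from le[of g] le[of "transpose g"] show ?thesis
    unfolding theta_O_def transpose_transpose by (metis subset_antisym)
qed

lemma rs3_sigma_commute: "rs3_sigma \<theta>s g i j = rs3_sigma \<theta>s g j i"
  using theta_O_transpose[of "g j ** transpose (g i)"]
  by (simp add: rs3_sigma_def matrix_transpose_mul transpose_transpose)

text \<open>Replacing \<open>k\<close> by \<open>- k\<close> shows that both infima range over the
  same set, so no minimizer has to be exhibited.\<close>

lemma rs2_sigma_commute: "rs2_sigma f \<theta> i j = rs2_sigma f \<theta> j i"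
proof -
  have le: "(\<lambda>k::int. f \<bar>\<theta> i - \<theta> j + real_of_int k * pi / 2\<bar>) ` UNIV
      \<subseteq> (\<lambda>k::int. f \<bar>\<theta> j - \<theta> i + real_of_int k * pi / 2\<bar>) ` UNIV" for i j
  proof (rule image_subsetI)
    fix k :: int
    have "\<bar>\<theta> i - \<theta> j + real_of_int k * pi / 2\<bar> = \<bar>\<theta> j - \<theta> i + real_of_int (- k) * pi / 2\<bar>"
      by (simp add: abs_if field_simps)
    then show "f \<bar>\<theta> i - \<theta> j + real_of_int k * pi / 2\<bar>
        \<in> (\<lambda>k::int. f \<bar>\<theta> j - \<theta> i + real_of_int k * pi / 2\<bar>) ` UNIV"
      by (intro image_eqI[where x="- k"]) simp_all
  qed
  from le[of i j] le[of j i] show ?thesis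
    unfolding rs2_sigma_def by (metis subset_antisym)
qed

subsection \<open>Conditionally negative coefficient matrices\<close>

lemma symmetric_matrix_inner:
  fixes B :: "real^'n^'n"
  assumes "transpose B = B"
  shows "v \<bullet> (B *v w) = w \<bullet> (B *v v)"
proof -
  have "v v* B = B *v v"
    using transpose_matrix_vector[of B v] assms by simp
  then show ?thesis
    using dot_lmul_matrix[of v B w] by (simp add: inner_commute)
qed

text \<open>The Rayleigh quotient attains its maximum on the compact unit sphere of
  \<open>S\<close>. A maximizer is critical, and invariance of \<open>S\<close> keeps the direction
  tested below inside \<open>S\<close>, so the maximizer is an eigenvector of \<open>B\<close>
  itself and not just of its compression to \<open>S\<close>.\<close>

lemma rayleigh_maximizer:
  fixes B :: "real^'n^'n"
  assumes sym: "transpose B = B" and S: "subspace S"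
    and inv: "\<And>v. v \<in> S \<Longrightarrow> B *v v \<in> S" and nz: "\<exists>v\<in>S. v \<noteq> 0"
  obtains c v where "v \<in> S" "v \<noteq> 0" "B *v v = c *\<^sub>R v"
    "\<And>w. w \<in> S \<Longrightarrow> w \<bullet> (B *v w) \<le> c * (w \<bullet> w)"
proof -
  let ?f = "\<lambda>v. v \<bullet> (B *v v)"
  let ?K = "S \<inter> sphere 0 1"
  have "compact ?K"
    by (simp add: closed_subspace[OF S] closed_Int_compact)
  moreover obtain u where u: "u \<in> S" "u \<noteq> 0" using nz by blast
  then have "(1 / norm u) *\<^sub>R u \<in> ?K"
    by (auto simp: subspace_scale[OF S])
  then have "?K \<noteq> {}" by blast
  moreover have "continuous_on ?K ?f"
    by (intro continuous_intros linear_continuous_on linear_linear[THEN iffD1])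
       (auto simp: linear_linear matrix_vector_mul_linear)
  ultimately obtain v where v: "v \<in> ?K" and max: "\<And>w. w \<in> ?K \<Longrightarrow> ?f w \<le> ?f v"
    using continuous_attains_sup[of ?K ?f] by blast
  define c where "c = ?f v"
  have vS: "v \<in> S" and vv: "v \<bullet> v = 1"
    using v by (auto simp: norm_eq_1)
  have bound: "?f w \<le> c * (w \<bullet> w)" if "w \<in> S" for w
  proof (cases "w = 0")
    case False
    then have "(1 / norm w) *\<^sub>R w \<in> ?K"
      using that by (auto simp: subspace_scale[OF S])
    from max[OF this] have "?f w / (norm w)\<^sup>2 \<le> c"
      by (simp add: c_def matrix_vector_mult_scaleR power2_eq_square)
    then show ?thesis
      using False by (simp add: field_simps power2_norm_eq_inner)
  qed simp
  \<comment> \<open>\<open>w\<close> is the residual of the eigenvalue equation and, up to a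
    positive factor, the direction of steepest descent of the quotient at \<open>v\<close>; the aim
    is \<open>w = 0\<close>.\<close>
  define w where "w = c *\<^sub>R v - B *v v"
  have wS: "w \<in> S"
    by (simp add: w_def S vS inv subspace_diff subspace_scale)
  \<comment> \<open>The gap between the two sides of \<open>bound\<close> vanishes at
    \<open>v\<close>, so along the line it is a polynomial in \<open>t\<close> without constant
    term. Being nonnegative for both signs of \<open>t\<close>, it forces the linear coefficient
    \<open>2 * (w \<bullet> w)\<close> to vanish.\<close>
  have expand: "c * ((v + t *\<^sub>R w) \<bullet> (v + t *\<^sub>R w)) - ?f (v + t *\<^sub>R w)
      = 2 * t * (w \<bullet> w) + t\<^sup>2 * (c * (w \<bullet> w) - ?f w)" for t
  proof -
    have "B *v v = c *\<^sub>R v - w" by (simp add: w_def)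
    then have e1: "w \<bullet> (B *v v) = c * (v \<bullet> w) - w \<bullet> w"
      by (simp add: inner_diff_right inner_commute)
    have e2: "v \<bullet> (B *v w) = c * (v \<bullet> w) - w \<bullet> w"
      using symmetric_matrix_inner[OF sym, of v w] e1 by simp
    have "?f (v + t *\<^sub>R w) = c + 2 * t * (c * (v \<bullet> w) - w \<bullet> w) + t\<^sup>2 * ?f w"
      by (simp add: matrix_vector_right_distrib matrix_vector_mult_scaleR inner_add_left
          inner_add_right e1 e2 c_def[symmetric] power2_eq_square algebra_simps)
    moreover have "(v + t *\<^sub>R w) \<bullet> (v + t *\<^sub>R w) = 1 + 2 * t * (v \<bullet> w) + t\<^sup>2 * (w \<bullet> w)"
      by (simp add: inner_add_left inner_add_right vv inner_commute[of w v] power2_eq_square algebra_simps)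
    ultimately show ?thesis by (simp add: algebra_simps)
  qed
  have "0 \<le> 2 * t * (w \<bullet> w) + t\<^sup>2 * (c * (w \<bullet> w) - ?f w)" for t
    using bound[of "v + t *\<^sub>R w"] expand[of t] S vS wS
    by (simp add: subspace_add subspace_scale)
  note pos = this
  have "w \<bullet> w = 0"
  proof (rule ccontr)
    assume "w \<bullet> w \<noteq> 0"
    then have p: "w \<bullet> w > 0" by simp
    define T where "T = c * (w \<bullet> w) - ?f w"
    have T: "T \<ge> 0" using bound[OF wS] by (simp add: T_def)
    \<comment> \<open>A negative step so short that the linear term wins: \<open>t * T\<close> stays
      above \<open>- (w \<bullet> w)\<close>. The \<open>+ 1\<close> covers
      \<open>T = 0\<close>.\<close>
    define t where "t = - (w \<bullet> w) / (T + 1)"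
    have t0: "t < 0" using p T by (simp add: t_def)
    have "t * T \<ge> - (w \<bullet> w)"
      using p T by (simp add: t_def field_simps)
    then have "2 * (w \<bullet> w) + t * T > 0" using p by linarith
    then have "t * (2 * (w \<bullet> w) + t * T) < 0" using t0 by (simp add: mult_neg_pos)
    with pos[of t] show False
      by (simp add: T_def algebra_simps power2_eq_square)
  qed
  then have "B *v v = c *\<^sub>R v" by (simp add: w_def)
  moreover have "v \<noteq> 0" using vv by auto
  ultimately show thesis using that vS bound by blast
qed

text \<open>Eigenvectors of distinct eigenvalues of a symmetric matrix are orthogonal, hence
  independent. Finiteness is what makes the \<open>Max\<close> and \<open>Min\<close> of the
  eigenvalue hypotheses genuine bounds for the members of the set.\<close>

lemma finite_eigs_perp:
  fixes B :: "real^'n^'n"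
  assumes sym: "transpose B = B"
  shows "finite (eigs_perp B)"
proof -
  have "\<forall>c\<in>eigs_perp B. \<exists>v. v \<noteq> 0 \<and> B *v v = c *\<^sub>R v"
    by (auto simp: eigs_perp_def)
  then obtain f where f: "\<And>c. c \<in> eigs_perp B \<Longrightarrow> f c \<noteq> 0 \<and> B *v f c = c *\<^sub>R f c"
    by metis
  have orth: "f c \<bullet> f d = 0" if "c \<in> eigs_perp B" "d \<in> eigs_perp B" "c \<noteq> d" for c d
    using symmetric_matrix_inner[OF sym, of "f c" "f d"] f[OF that(1)] f[OF that(2)] that(3)
    by (auto simp: inner_commute)
  have inj: "inj_on f (eigs_perp B)"
    by (rule inj_onI) (metis f orth inner_eq_zero_iff)
  have "pairwise orthogonal (f ` eigs_perp B)"
    using orth by (fastforce simp: pairwise_def orthogonal_def)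
  moreover have "0 \<notin> f ` eigs_perp B" using f by force
  ultimately have "finite (f ` eigs_perp B)"
    by (simp add: pairwise_orthogonal_independent independent_imp_finite)
  with inj show ?thesis by (simp add: finite_image_iff)
qed

section \<open>The centering projection and spectral bounds orthogonal to
  \<open>e_vec\<close>\<close>

lemma transpose_J_mat: "transpose J_mat = (J_mat :: real^'n^'n)"
  by (auto simp: J_mat_def transpose_def vec_eq_iff)

lemma J_mat_mult: "J_mat *v v = v - ((v \<bullet> e_vec) / real CARD('n)) *\<^sub>R e_vec"
  for v :: "real^'n"
  by (simp add: J_mat_def e_vec_def vec_eq_iff matrix_vector_mult_def inner_vec_def
      left_diff_distrib sum_subtractf if_distrib[where f="\<lambda>x. x * _"] sum_divide_distrib cong: if_cong)

lemma J_mat_perp: "(J_mat *v v) \<bullet> e_vec = 0" for v :: "real^'n"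
  by (simp add: J_mat_mult inner_diff_left) (simp add: e_vec_def inner_vec_def)

lemma J_mat_fixes: "v \<bullet> e_vec = 0 \<Longrightarrow> J_mat *v v = v"
  by (simp add: J_mat_mult)

lemma transpose_conj_J_mat:
  assumes "transpose S = S"
  shows "transpose (J_mat ** S ** J_mat) = J_mat ** S ** (J_mat :: real^'n^'n)"
  using assms by (simp add: matrix_transpose_mul transpose_J_mat matrix_mul_assoc)

text \<open>Turns a bound for \<open>J_mat ** S ** J_mat\<close>, which maps into the complement of
  \<open>e_vec\<close>, into one for \<open>S\<close>, which may map out of it.\<close>

lemma conj_J_mat_quadratic:
  assumes "v \<bullet> e_vec = 0"
  shows "v \<bullet> ((J_mat ** S ** J_mat) *v v) = v \<bullet> (S *v v)"
proof -
  have "v \<bullet> ((J_mat ** S ** J_mat) *v v) = v \<bullet> (J_mat *v (S *v v))"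
    using assms by (simp add: J_mat_fixes flip: matrix_vector_mul_assoc)
  also have "\<dots> = (S *v v) \<bullet> (J_mat *v v)"
    by (rule symmetric_matrix_inner[OF transpose_J_mat])
  finally show ?thesis using assms by (simp add: J_mat_fixes inner_commute)
qed

lemma perp_e_vec_nontrivial:
  assumes "CARD('n) \<ge> 2"
  shows "\<exists>v::real^'n. v \<bullet> e_vec = 0 \<and> v \<noteq> 0"
proof -
  obtain i j :: 'n where "i \<noteq> j"
    using assms card_le_Suc0_iff_eq[of "UNIV :: 'n set"] by auto
  then have "(axis i 1 - axis j 1 :: real^'n) \<bullet> e_vec = 0" "(axis i 1 - axis j 1 :: real^'n) \<noteq> 0"
    by (auto simp: e_vec_def inner_diff_left inner_axis' axis_eq_axis)
  then show ?thesis by blast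
qed

lemma symmetric_top_eig_perp:
  fixes B :: "real^'n^'n"
  assumes N: "CARD('n) \<ge> 2" and sym: "transpose B = B"
    and inv: "\<And>v. v \<bullet> e_vec = 0 \<Longrightarrow> (B *v v) \<bullet> e_vec = 0"
  obtains c where "c \<in> eigs_perp B" "\<And>w. w \<bullet> e_vec = 0 \<Longrightarrow> w \<bullet> (B *v w) \<le> c * (w \<bullet> w)"
proof (rule rayleigh_maximizer[OF sym, of "{v. v \<bullet> e_vec = 0}"])
  show "subspace {v. v \<bullet> (e_vec :: real^'n) = 0}"
    by (simp add: subspace_def inner_add_left)
  show "\<exists>v\<in>{v. v \<bullet> (e_vec :: real^'n) = 0}. v \<noteq> 0"
    using perp_e_vec_nontrivial[OF N] by auto
next
  fix c v
  assume v: "v \<in> {v. v \<bullet> e_vec = 0}" "v \<noteq> 0" "B *v v = c *\<^sub>R v"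
    and c: "\<And>w. w \<in> {v. v \<bullet> e_vec = 0} \<Longrightarrow> w \<bullet> (B *v w) \<le> c * (w \<bullet> w)"
  have "c \<in> eigs_perp B" using v unfolding eigs_perp_def by blast
  then show thesis using c by (rule that) simp
qed (simp add: inv)

lemma quadratic_le_Max_eigs_perp:
  fixes S :: "real^'n^'n"
  assumes N: "CARD('n) \<ge> 2" and sym: "transpose S = S" and v: "v \<bullet> e_vec = 0"
  shows "v \<bullet> (S *v v) \<le> Max (eigs_perp (J_mat ** S ** J_mat)) * (v \<bullet> v)"
proof -
  define B where "B = J_mat ** S ** J_mat"
  have tB: "transpose B = B" using transpose_conj_J_mat[OF sym] by (simp add: B_def)
  have "(B *v w) \<bullet> e_vec = 0" for w
    unfolding B_def by (simp only: matrix_vector_mul_assoc[symmetric] J_mat_perp)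
  then obtain c where c: "c \<in> eigs_perp B" "v \<bullet> (B *v v) \<le> c * (v \<bullet> v)"
    using symmetric_top_eig_perp[OF N tB] v by metis
  have "c \<le> Max (eigs_perp B)"
    using c(1) by (simp add: finite_eigs_perp[OF tB])
  then have "c * (v \<bullet> v) \<le> Max (eigs_perp B) * (v \<bullet> v)"
    by (simp add: mult_right_mono)
  with c(2) conj_J_mat_quadratic[OF v, of S] show ?thesis by (simp add: B_def)
qed

text \<open>Obtained from the top eigenvalue of \<open>- B\<close>, whose negative is an eigenvalue
  of \<open>B\<close>.\<close>

lemma Min_eigs_perp_le_quadratic:
  fixes S :: "real^'n^'n"
  assumes N: "CARD('n) \<ge> 2" and sym: "transpose S = S" and v: "v \<bullet> e_vec = 0"
  shows "Min (eigs_perp (J_mat ** S ** J_mat)) * (v \<bullet> v) \<le> v \<bullet> (S *v v)"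
proof -
  define B where "B = J_mat ** S ** J_mat"
  have tB: "transpose B = B" using transpose_conj_J_mat[OF sym] by (simp add: B_def)
  then have tB': "transpose (- B) = - B" by (simp add: transpose_def vec_eq_iff)
  have neg: "(- B) *v w = - (B *v w)" for w
    by (simp add: matrix_vector_mult_def vec_eq_iff sum_negf)
  have "(B *v w) \<bullet> e_vec = 0" for w
    unfolding B_def by (simp only: matrix_vector_mul_assoc[symmetric] J_mat_perp)
  then have "((- B) *v w) \<bullet> e_vec = 0" for w by (simp add: neg)
  then obtain c where c: "c \<in> eigs_perp (- B)" "v \<bullet> ((- B) *v v) \<le> c * (v \<bullet> v)"
    using symmetric_top_eig_perp[OF N tB'] v by metis
  have "- c \<in> eigs_perp B"
    using c(1) by (auto simp: eigs_perp_def neg minus_equation_iff[of "_ *v _"]) 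
  then have "Min (eigs_perp B) \<le> - c"
    by (simp add: finite_eigs_perp[OF tB])
  then have "Min (eigs_perp B) * (v \<bullet> v) \<le> - c * (v \<bullet> v)"
    by (rule mult_right_mono) simp
  moreover have "v \<bullet> ((- B) *v v) = - (v \<bullet> (B *v v))" by (simp only: neg inner_minus_right)
  ultimately show ?thesis using c(2) conj_J_mat_quadratic[OF v, of S] by (simp add: B_def)
qed

text \<open>With all reciprocal mobilities equal to one the matrix is \<open>e e^T - I\<close>. At
  least two grains are needed for an eigenvector orthogonal to \<open>e\<close> to exist.\<close>

lemma eigs_perp_recip_mob:
  assumes N: "CARD('n) \<ge> 2"
  shows "eigs_perp (J_mat ** recip_mob_mat (\<lambda>i j. 1) ** J_mat :: real^'n^'n) = {-1}"
proof -
  have M: "recip_mob_mat (\<lambda>i j. 1) *v v = - v" if "v \<bullet> e_vec = 0" for v :: "real^'n"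
  proof -
    have "(\<Sum>j\<in>UNIV. (if i = j then 0 else 1) * v $ j) = - v $ i" for i
    proof -
      have "(\<Sum>j\<in>UNIV. (if i = j then 0 else 1) * v $ j)
          = (\<Sum>j\<in>UNIV. v $ j - (if i = j then v $ j else 0))"
        by (rule sum.cong) auto
      also have "\<dots> = - v $ i"
        using that by (simp add: sum_subtractf inner_vec_def e_vec_def)
      finally show ?thesis .
    qed
    then show ?thesis
      by (simp add: vec_eq_iff recip_mob_mat_def matrix_vector_mult_def cong: if_cong)
  qed
  have "(J_mat ** recip_mob_mat (\<lambda>i j. 1) ** J_mat) *v v = - v" if "v \<bullet> e_vec = 0" for v :: "real^'n"
    using that by (simp add: J_mat_fixes M flip: matrix_vector_mul_assoc)
  moreover have "- v = c *\<^sub>R v \<longleftrightarrow> c = -1" if "v \<noteq> 0" for c and v :: "real^'n"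
    using that by (metis scaleR_cancel_right scaleR_minus1_left)
  ultimately show ?thesis
    using perp_e_vec_nontrivial[OF N] by (auto simp: eigs_perp_def)
qed

text \<open>Both kernel coefficients are affine in the tension. On vectors of sum zero the constant
  part \<open>q\<close> contributes \<open>- q * |v|^2\<close>, because the entries other than
  \<open>v i\<close> add up to \<open>- v i\<close>.\<close>

lemma off_diagonal_quadratic:
  fixes \<sigma> :: "'n::finite \<Rightarrow> 'n \<Rightarrow> real"
  assumes v: "(\<Sum>i\<in>UNIV. v i) = 0"
  shows "(\<Sum>i\<in>UNIV. \<Sum>j\<in>UNIV - {i}. (p * \<sigma> i j + q) * v i * v j)
    = p * ((\<chi> i. v i) \<bullet> (tension_mat \<sigma> *v (\<chi> i. v i))) - q * ((\<chi> i. v i) \<bullet> (\<chi> i. v i))"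
proof -
  have "(\<Sum>j\<in>UNIV - {i}. (p * \<sigma> i j + q) * v i * v j)
      = p * (v i * (\<Sum>j\<in>UNIV. (if i = j then 0 else \<sigma> i j) * v j)) - q * (v i * v i)" for i
  proof -
    have "(\<Sum>j\<in>UNIV - {i}. (p * \<sigma> i j + q) * v i * v j)
        = p * v i * (\<Sum>j\<in>UNIV - {i}. \<sigma> i j * v j) + q * v i * (\<Sum>j\<in>UNIV - {i}. v j)"
      by (simp add: sum_distrib_left algebra_simps sum.distrib)
    moreover have "(\<Sum>j\<in>UNIV - {i}. v j) = - v i"
      using v by (simp add: sum_diff1)
    moreover have "(\<Sum>j\<in>UNIV. (if i = j then 0 else \<sigma> i j) * v j) = (\<Sum>j\<in>UNIV - {i}. \<sigma> i j * v j)"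
      by (rule sum.mono_neutral_cong_right) auto
    ultimately show ?thesis by simp
  qed
  then show ?thesis
    by (simp add: inner_vec_def matrix_vector_mult_def tension_mat_def sum_subtractf
        sum_distrib_left cong: if_cong)
qed

lemma transpose_tension_mat:
  assumes "\<And>i j. \<sigma> i j = \<sigma> j i"
  shows "transpose (tension_mat \<sigma>) = tension_mat \<sigma>"
  using assms by (auto simp: transpose_def tension_mat_def vec_eq_iff)

text \<open>The coefficient is a positive multiple of \<open>\<sigma> - \<beta>\<close>, increasing
  in the tension, so it is the upper end of the tension spectrum that must not exceed
  \<open>- \<beta>\<close>.\<close>

lemma a_coef_conditionally_negative:
  fixes \<sigma> :: "'n::finite \<Rightarrow> 'n \<Rightarrow> real"
  assumes N: "CARD('n) \<ge> 2" and sym: "\<And>i j. \<sigma> i j = \<sigma> j i" and ab: "\<alpha> > \<beta>" "\<beta> > 0"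
    and beta: "\<beta> \<le> - Max (eigs_perp (J_mat ** tension_mat \<sigma> ** J_mat))"
    and v: "(\<Sum>i\<in>UNIV. v i) = 0"
  shows "(\<Sum>i\<in>UNIV. \<Sum>j\<in>UNIV - {i}. a_coef \<alpha> \<beta> (\<sigma> i j) 1 * v i * v j) \<le> 0"
proof -
  let ?v = "\<chi> i. v i"
  define k where "k = sqrt pi * sqrt \<alpha> / (\<alpha> - \<beta>)"
  have perp: "?v \<bullet> e_vec = 0" using v by (simp add: inner_vec_def e_vec_def)
  have "a_coef \<alpha> \<beta> s 1 = k * s + - k * \<beta>" for s
    by (simp add: a_coef_def k_def[symmetric] right_diff_distrib)
  then have eq: "(\<Sum>i\<in>UNIV. \<Sum>j\<in>UNIV - {i}. a_coef \<alpha> \<beta> (\<sigma> i j) 1 * v i * v j)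
      = k * (?v \<bullet> (tension_mat \<sigma> *v ?v) + \<beta> * (?v \<bullet> ?v))"
    using off_diagonal_quadratic[OF v, of k \<sigma> "- k * \<beta>"] by (simp add: distrib_left)
  have neg: "?v \<bullet> (tension_mat \<sigma> *v ?v) + \<beta> * (?v \<bullet> ?v) \<le> 0"
    using quadratic_le_Max_eigs_perp[OF N transpose_tension_mat[of \<sigma>, OF sym] perp]
      mult_right_mono[OF beta inner_ge_zero[of ?v]] by linarith
  have "k \<ge> 0" unfolding k_def using ab by (intro divide_nonneg_nonneg mult_nonneg_nonneg) auto
  with neg show ?thesis unfolding eq by (rule mult_nonneg_nonpos[rotated])
qed

text \<open>Here the coefficient is a positive multiple of \<open>\<alpha> - \<sigma>\<close>, so
  the lower end of the spectrum decides: it must not fall below \<open>- \<alpha>\<close>.\<close>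

lemma b_coef_conditionally_negative:
  fixes \<sigma> :: "'n::finite \<Rightarrow> 'n \<Rightarrow> real"
  assumes N: "CARD('n) \<ge> 2" and sym: "\<And>i j. \<sigma> i j = \<sigma> j i" and ab: "\<alpha> > \<beta>" "\<beta> > 0"
    and alpha: "\<alpha> \<ge> - Min (eigs_perp (J_mat ** tension_mat \<sigma> ** J_mat))"
    and v: "(\<Sum>i\<in>UNIV. v i) = 0"
  shows "(\<Sum>i\<in>UNIV. \<Sum>j\<in>UNIV - {i}. b_coef \<alpha> \<beta> (\<sigma> i j) 1 * v i * v j) \<le> 0"
proof -
  let ?v = "\<chi> i. v i"
  define k where "k = sqrt pi * sqrt \<beta> / (\<alpha> - \<beta>)"
  have perp: "?v \<bullet> e_vec = 0" using v by (simp add: inner_vec_def e_vec_def)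
  have "b_coef \<alpha> \<beta> s 1 = - k * s + k * \<alpha>" for s
    by (simp add: b_coef_def k_def[symmetric] right_diff_distrib)
  then have eq: "(\<Sum>i\<in>UNIV. \<Sum>j\<in>UNIV - {i}. b_coef \<alpha> \<beta> (\<sigma> i j) 1 * v i * v j)
      = k * (- (?v \<bullet> (tension_mat \<sigma> *v ?v)) - \<alpha> * (?v \<bullet> ?v))"
    using off_diagonal_quadratic[OF v, of "- k" \<sigma> "k * \<alpha>"] by (simp add: right_diff_distrib)
  have neg: "- (?v \<bullet> (tension_mat \<sigma> *v ?v)) - \<alpha> * (?v \<bullet> ?v) \<le> 0"
    using Min_eigs_perp_le_quadratic[OF N transpose_tension_mat[of \<sigma>, OF sym] perp]
      mult_right_mono[OF alpha inner_ge_zero[of ?v]] by linarith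
  have "k \<ge> 0" unfolding k_def using ab by (intro divide_nonneg_nonneg mult_nonneg_nonneg) auto
  with neg show ?thesis unfolding eq by (rule mult_nonneg_nonpos[rotated])
qed

subsection \<open>Lattice unfolding\<close>

text \<open>Integer coefficients rather than lattice points serve as indices: they form a countable
  type, so lattice sums become integrals against \<open>count_space UNIV\<close>.\<close>

definition lattice_vec :: "real^'d^'d \<Rightarrow> ('d \<Rightarrow> int) \<Rightarrow> real^'d" where
  "lattice_vec A k = A *v (\<chi> i. real_of_int (k i))"

lemma lattice_vec_add: "lattice_vec A k + lattice_vec A m = lattice_vec A (\<lambda>i. k i + m i)"
  by (simp add: lattice_vec_def flip: matrix_vector_right_distrib)
     (simp add: matrix_vector_mult_def vec_eq_iff)

lemma lattice_vec_minus: "lattice_vec A (\<lambda>i. - k i) = - lattice_vec A k"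
  by (simp add: lattice_vec_def matrix_vector_mult_def vec_eq_iff sum_negf)

lemma periodic_set_iff: "periodic_set A S \<longleftrightarrow> (\<forall>x k. x + lattice_vec A k \<in> S \<longleftrightarrow> x \<in> S)"
  by (auto simp: periodic_set_def lattice_def lattice_vec_def)

lemma indicator_periodic:
  "periodic_set A S \<Longrightarrow> indicator S (x + lattice_vec A k) = indicator S x"
  by (simp add: periodic_set_iff indicator_def)

lemma fund_dom_iff:
  fixes A B :: "real^'d^'d"
  assumes "A ** B = mat 1" "B ** A = mat 1"
  shows "x \<in> fund_dom A \<longleftrightarrow> (\<forall>i. 0 \<le> (B *v x) $ i \<and> (B *v x) $ i < 1)"
proof -
  have "A *v (B *v z) = z" "B *v (A *v z) = z" for z
    using assms by (simp_all add: matrix_vector_mul_assoc)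
  then show ?thesis
    unfolding fund_dom_def by (auto intro!: image_eqI[where x="B *v x"])
qed

text \<open>The coefficients are the floors of the coordinates of \<open>x\<close> in the lattice
  basis; half-open cells leave no choice on the boundary.\<close>

lemma fund_dom_translate_unique:
  fixes A :: "real^'d^'d"
  assumes "invertible A"
  shows "\<exists>!k. x - lattice_vec A k \<in> fund_dom A"
proof -
  obtain B where B: "A ** B = mat 1" "B ** A = mat 1"
    using assms by (auto simp: invertible_def)
  have "B *v lattice_vec A k = (\<chi> i. real_of_int (k i))" for k
    using B(2) by (simp add: lattice_vec_def matrix_vector_mul_assoc)
  then have *: "x - lattice_vec A k \<in> fund_dom A \<longleftrightarrow> k = (\<lambda>i. \<lfloor>(B *v x) $ i\<rfloor>)" for k
    unfolding fund_dom_iff[OF B] fun_eq_iff matrix_vector_mult_diff_distrib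
    by (simp add: floor_eq_iff eq_commute[of "k _"]) (simp add: algebra_simps)
  show ?thesis unfolding * by simp
qed

lemma fund_dom_borel [measurable]:
  fixes A :: "real^'d^'d"
  assumes "invertible A"
  shows "fund_dom A \<in> sets borel"
proof -
  obtain B where B: "A ** B = mat 1" "B ** A = mat 1"
    using assms by (auto simp: invertible_def)
  have [measurable]: "(\<lambda>x. (B *v x) $ i) \<in> borel_measurable borel" for i
    by (intro borel_measurable_continuous_onI continuous_intros linear_continuous_on
        linear_linear[THEN iffD1] matrix_vector_mul_linear)
  have "fund_dom A = (\<Inter>i. {x. 0 \<le> (B *v x) $ i \<and> (B *v x) $ i < 1})"
    using fund_dom_iff[OF B] by auto
  also have "\<dots> \<in> sets borel"
    by (rule sets.finite_INT) auto
  finally show ?thesis .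
qed

lemma fund_dom_finite_measure:
  fixes A :: "real^'d^'d"
  shows "emeasure lborel (fund_dom A) < \<infinity>"
proof -
  have "bounded (cbox (vec 0) (vec 1) :: (real^'d) set)" by simp
  moreover have "{y::real^'d. \<forall>i. 0 \<le> y $ i \<and> y $ i < 1} \<subseteq> cbox (vec 0) (vec 1)"
    by (auto simp: mem_box_cart less_imp_le)
  ultimately have "bounded (fund_dom A)"
    unfolding fund_dom_def
    by (intro bounded_linear_image[OF bounded_subset] matrix_vector_mul_bounded_linear)
  then show ?thesis by (rule emeasure_bounded_finite)
qed

section \<open>Integrals over the whole space as lattice sums over one cell\<close>

lemma nn_integral_lborel_translate:
  fixes f :: "'a::euclidean_space \<Rightarrow> ennreal"
  assumes [measurable]: "f \<in> borel_measurable borel"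
  shows "(\<integral>\<^sup>+x. f (x + c) \<partial>lborel) = (\<integral>\<^sup>+x. f x \<partial>lborel)"
proof -
  have "(\<integral>\<^sup>+x. f x \<partial>lborel) = (\<integral>\<^sup>+x. f x \<partial>distr lborel borel ((+) c))"
    by (simp add: lborel_distr_plus)
  also have "\<dots> = (\<integral>\<^sup>+x. f (c + x) \<partial>lborel)"
    by (subst nn_integral_distr) auto
  finally show ?thesis by (simp add: add.commute)
qed

text \<open>Each point lies in exactly one translate of the cell, so the indicators of the
  translates add up to one. This sum is inserted under the integral, exchanged with it, and each
  term is translated back to \<open>fund_dom A\<close>.\<close>

lemma nn_integral_unfold_lattice:
  fixes A :: "real^'d^'d" and f :: "real^'d \<Rightarrow> ennreal"
  assumes A: "invertible A" and f [measurable]: "f \<in> borel_measurable borel"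
  shows "(\<integral>\<^sup>+x. f x \<partial>lborel)
    = (\<integral>\<^sup>+k. \<integral>\<^sup>+x. indicator (fund_dom A) x * f (x + lattice_vec A k) \<partial>lborel \<partial>count_space UNIV)"
proof -
  note [measurable] = fund_dom_borel[OF A]
  let ?g = "\<lambda>k x. indicator (fund_dom A) (x - lattice_vec A k) * f x"
  have "f x = (\<integral>\<^sup>+k. ?g k x \<partial>count_space UNIV)" for x
  proof -
    obtain m where "\<And>k. x - lattice_vec A k \<in> fund_dom A \<longleftrightarrow> k = m"
      using fund_dom_translate_unique[OF A, of x] by blast
    then have "(\<integral>\<^sup>+k. ?g k x \<partial>count_space UNIV) = (\<Sum>k\<in>{m}. ?g k x)"
      by (intro nn_integral_count_space') auto
    then show ?thesis using \<open>\<And>k. _ k \<longleftrightarrow> k = m\<close> by simp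
  qed
  then have "(\<integral>\<^sup>+x. f x \<partial>lborel) = (\<integral>\<^sup>+x. \<integral>\<^sup>+k. ?g k x \<partial>count_space UNIV \<partial>lborel)"
    by simp
  also have "\<dots> = (\<integral>\<^sup>+k. \<integral>\<^sup>+x. ?g k x \<partial>lborel \<partial>count_space UNIV)"
    by (rule nn_integral_count_space_nn_integral) auto
  also have "\<dots> = (\<integral>\<^sup>+k. \<integral>\<^sup>+x. ?g k (x + lattice_vec A k) \<partial>lborel \<partial>count_space UNIV)"
    by (intro nn_integral_cong nn_integral_lborel_translate[symmetric]) measurable
  finally show ?thesis by simp
qed

text \<open>One variable runs over the cell and the other over the whole space, so Fubini alone does
  not exchange them. Unfolding the inner variable gives a lattice sum of integrals over cell times
  cell; there, invariance under joint shifts trades a shift of one variable by \<open>k\<close> for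
  a shift of the other by \<open>- k\<close>, and the sum over \<open>k\<close> absorbs the
  sign.\<close>

lemma nn_integral_diag_periodic_swap:
  fixes A :: "real^'d^'d" and f :: "real^'d \<Rightarrow> real^'d \<Rightarrow> ennreal"
  assumes A: "invertible A"
    and f [measurable]: "(\<lambda>(x, z). f x z) \<in> borel_measurable (borel \<Otimes>\<^sub>M borel)"
    and per: "\<And>x z k. f (x + lattice_vec A k) (z + lattice_vec A k) = f x z"
  shows "(\<integral>\<^sup>+x. indicator (fund_dom A) x * (\<integral>\<^sup>+z. f x z \<partial>lborel) \<partial>lborel)
    = (\<integral>\<^sup>+z. indicator (fund_dom A) z * (\<integral>\<^sup>+x. f x z \<partial>lborel) \<partial>lborel)"
proof -
  note [measurable] = fund_dom_borel[OF A]
  let ?F = "indicator (fund_dom A) :: real^'d \<Rightarrow> ennreal" and ?l = "lattice_vec A"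
  \<comment> \<open>Applied once to \<open>f\<close> and once to \<open>f\<close> with its arguments
    exchanged.\<close>
  have half: "(\<integral>\<^sup>+x. ?F x * (\<integral>\<^sup>+z. g x z \<partial>lborel) \<partial>lborel)
      = (\<integral>\<^sup>+k. \<integral>\<^sup>+x. \<integral>\<^sup>+z. ?F x * ?F z * g x (z + ?l k) \<partial>lborel \<partial>lborel \<partial>count_space UNIV)"
    if [measurable]: "(\<lambda>(x, z). g x z) \<in> borel_measurable (borel \<Otimes>\<^sub>M borel)" for g
  proof -
    have "(\<integral>\<^sup>+x. ?F x * (\<integral>\<^sup>+z. g x z \<partial>lborel) \<partial>lborel)
        = (\<integral>\<^sup>+x. \<integral>\<^sup>+k. ?F x * (\<integral>\<^sup>+z. ?F z * g x (z + ?l k) \<partial>lborel) \<partial>count_space UNIV \<partial>lborel)"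
      by (subst nn_integral_unfold_lattice[OF A]) (auto simp: nn_integral_cmult)
    also have "\<dots> = (\<integral>\<^sup>+k. \<integral>\<^sup>+x. ?F x * (\<integral>\<^sup>+z. ?F z * g x (z + ?l k) \<partial>lborel) \<partial>lborel \<partial>count_space UNIV)"
      by (rule nn_integral_count_space_nn_integral) auto
    also have "\<dots> = (\<integral>\<^sup>+k. \<integral>\<^sup>+x. \<integral>\<^sup>+z. ?F x * ?F z * g x (z + ?l k) \<partial>lborel \<partial>lborel \<partial>count_space UNIV)"
      by (intro nn_integral_cong) (simp add: nn_integral_cmult mult.assoc)
    finally show ?thesis .
  qed
  have shift: "f (x + ?l k) z = f x (z + ?l (\<lambda>i. - k i))" for x z k
    using per[of x k "z - ?l k"] by (simp add: lattice_vec_minus)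
  have bij: "bij_betw (\<lambda>k i. - k i) UNIV (UNIV :: ('d \<Rightarrow> int) set)"
    by (rule bij_betw_byWitness[where f'="\<lambda>k i. - k i"]) auto
  have "(\<integral>\<^sup>+z. ?F z * (\<integral>\<^sup>+x. f x z \<partial>lborel) \<partial>lborel)
      = (\<integral>\<^sup>+k. \<integral>\<^sup>+z. \<integral>\<^sup>+x. ?F z * ?F x * f (x + ?l k) z \<partial>lborel \<partial>lborel \<partial>count_space UNIV)"
    by (rule half) measurable
  also have "\<dots> = (\<integral>\<^sup>+k. \<integral>\<^sup>+z. \<integral>\<^sup>+x. ?F z * ?F x * f x (z + ?l (\<lambda>i. - k i)) \<partial>lborel \<partial>lborel \<partial>count_space UNIV)"
    by (simp only: shift)
  also have "\<dots> = (\<integral>\<^sup>+k. \<integral>\<^sup>+z. \<integral>\<^sup>+x. ?F z * ?F x * f x (z + ?l k) \<partial>lborel \<partial>lborel \<partial>count_space UNIV)"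
    by (rule nn_integral_bij_count_space[OF bij])
  also have "\<dots> = (\<integral>\<^sup>+k. \<integral>\<^sup>+x. \<integral>\<^sup>+z. ?F z * ?F x * f x (z + ?l k) \<partial>lborel \<partial>lborel \<partial>count_space UNIV)"
    by (intro nn_integral_cong lborel_pair.Fubini') measurable
  also have "\<dots> = (\<integral>\<^sup>+k. \<integral>\<^sup>+x. \<integral>\<^sup>+z. ?F x * ?F z * f x (z + ?l k) \<partial>lborel \<partial>lborel \<partial>count_space UNIV)"
    by (intro nn_integral_cong) (simp add: mult.commute)
  also have "\<dots> = (\<integral>\<^sup>+x. ?F x * (\<integral>\<^sup>+z. f x z \<partial>lborel) \<partial>lborel)"
    by (rule half[OF f, symmetric])
  finally show ?thesis by (rule sym)
qed

text \<open>A Borel subset \<open>C\<close> of full measure in \<open>S\<close> need not be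
  periodic, but the union of its translates is: it is Borel as a countable union, contains
  \<open>C\<close>, and stays inside \<open>S\<close> because \<open>S\<close> is periodic. Hence it
  differs from \<open>S\<close> only within the original null set.\<close>

lemma borel_periodic_representative:
  fixes A :: "real^'d^'d"
  assumes S: "S \<in> sets lebesgue" "periodic_set A S"
  obtains S' where "S' \<in> sets borel" "periodic_set A S'" "AE x in lebesgue. x \<in> S \<longleftrightarrow> x \<in> S'"
proof -
  obtain C M N where CM: "S = C \<union> M" "M \<subseteq> N" and N: "N \<in> null_sets lborel" and C: "C \<in> sets lborel"
    using sets_completionE[OF S(1)] by metis
  then have [measurable]: "C \<in> sets borel" by simp
  let ?l = "lattice_vec A"
  define S' where "S' = (\<Union>k. (\<lambda>x. x - ?l k) -` C)"
  have "(\<lambda>x. x - ?l k) -` C \<in> sets borel" for k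
    by (rule measurable_sets_borel[where M=borel]) auto
  then have "S' \<in> sets borel" unfolding S'_def by (intro sets.countable_UN') auto
  moreover have "periodic_set A S'"
  proof -
    have "x + ?l k \<in> S'" if "x \<in> S'" for x k
    proof -
      obtain m where "x - ?l m \<in> C" using \<open>x \<in> S'\<close> by (auto simp: S'_def)
      then have "x + ?l k - ?l (\<lambda>i. m i + k i) \<in> C"
        by (simp flip: lattice_vec_add)
      then show ?thesis unfolding S'_def by blast
    qed
    moreover from this[of "x + ?l k" "\<lambda>i. - k i" for x k] have "x \<in> S'" if "x + ?l k \<in> S'" for x k
      using that by (simp add: lattice_vec_minus)
    ultimately show ?thesis unfolding periodic_set_iff by blast
  qed
  moreover have "AE x in lebesgue. x \<in> S \<longleftrightarrow> x \<in> S'"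
  proof (rule AE_I'[OF null_sets_completionI[OF N]])
    have "S' \<subseteq> S"
    proof
      fix x assume "x \<in> S'"
      then obtain k where "x - ?l k \<in> S" using CM by (auto simp: S'_def)
      then show "x \<in> S" using S(2) unfolding periodic_set_iff by (metis diff_add_cancel)
    qed
    moreover have "C \<subseteq> S'"
    proof
      fix x assume "x \<in> C"
      then have "x - ?l (\<lambda>i. 0) \<in> C" by (simp add: lattice_vec_def matrix_vector_mult_def zero_vec_def[symmetric])
      then show "x \<in> S'" unfolding S'_def by blast
    qed
    ultimately show "{x \<in> space lebesgue. \<not> (x \<in> S \<longleftrightarrow> x \<in> S')} \<subseteq> N" using CM by auto
  qed
  ultimately show thesis by (rule that)
qed

subsection \<open>Gaussian pairings on the torus\<close>

text \<open>A Gaussian without its normalizing factor, of variance \<open>s / 2\<close> in each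
  coordinate. The width \<open>4 * g\<close> belongs to \<open>gauss g\<close>, the width
  \<open>2 * g\<close> to the Gaussian of half its variance, and the width \<open>g\<close> appears
  when two of the latter are convolved.\<close>

definition gexp :: "real \<Rightarrow> real^'d \<Rightarrow> real" where
  "gexp s x = exp (- (norm x)\<^sup>2 / s)"

lemma gexp_measurable [measurable]: "gexp s \<in> borel_measurable borel"
  unfolding gexp_def by measurable

lemma gexp_nonneg: "0 \<le> gexp s x"
  by (simp add: gexp_def)

lemma gexp_minus_commute: "gexp s (x - y) = gexp s (y - x)"
  by (simp add: gexp_def norm_minus_commute)

lemma nn_integral_gexp_finite:
  assumes "s > 0"
  shows "(\<integral>\<^sup>+x. ennreal (gexp s (x :: real^'d)) \<partial>lborel) < \<infinity>"
proof -
  \<comment> \<open>The standard deviation for which the exponent of \<open>normal_density\<close>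
    is \<open>- t\<^sup>2 / s\<close>; integrability in one dimension is taken from there and passes
    to the product over the coordinates.\<close>
  define r where "r = sqrt (s / 2)"
  have r: "r > 0" "2 * r\<^sup>2 = s" using assms by (auto simp: r_def)
  have "exp (- t\<^sup>2 / s) = sqrt (2 * pi * r\<^sup>2) * normal_density 0 r t" for t
    using r by (simp add: normal_density_def)
  then have "(\<lambda>t. exp (- t\<^sup>2 / s)) = (\<lambda>t. sqrt (2 * pi * r\<^sup>2) * normal_density 0 r t)"
    by (rule ext)
  then have "integrable lborel (\<lambda>t. exp (- t\<^sup>2 / s))"
    using r integrable_normal_density[of r 0] by simp
  then have one: "(\<integral>\<^sup>+t. ennreal (exp (- t\<^sup>2 / s)) \<partial>lborel) < \<infinity>"
    by (subst (asm) integrable_iff_bounded) simp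
  have "gexp s x = (\<Prod>b\<in>Basis. exp (- (x \<bullet> b)\<^sup>2 / s))" for x :: "real^'d"
    unfolding gexp_def power2_norm_eq_inner
    by (subst euclidean_inner)
       (simp add: exp_sum[symmetric] sum_negf sum_divide_distrib power2_eq_square)
  then have "(\<integral>\<^sup>+x. ennreal (gexp s (x :: real^'d)) \<partial>lborel)
      = (\<integral>\<^sup>+x. (\<Prod>b\<in>Basis. ennreal (exp (- ((x :: real^'d) \<bullet> b)\<^sup>2 / s))) \<partial>lborel)"
    by (simp add: prod_ennreal)
  also have "\<dots> = (\<Prod>b\<in>(Basis :: (real^'d) set). (\<integral>\<^sup>+t. ennreal (exp (- t\<^sup>2 / s)) \<partial>lborel))"
    by (rule nn_integral_lborel_prod) auto
  also have "\<dots> < \<infinity>"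
    using one by (simp add: power_less_top_ennreal)
  finally show ?thesis .
qed

text \<open>The value is \<open>(pi * s)^(d/2)\<close>; it enters as a finite positive constant. The
  \<open>itself\<close> argument records the dimension, which \<open>s\<close> does not
  determine.\<close>

definition gexp_mass :: "'d::finite itself \<Rightarrow> real \<Rightarrow> real" where
  "gexp_mass _ s = enn2real (\<integral>\<^sup>+x. ennreal (gexp s (x :: real^'d)) \<partial>lborel)"

lemma nn_integral_gexp:
  assumes "s > 0"
  shows "(\<integral>\<^sup>+x. ennreal (gexp s (x :: real^'d)) \<partial>lborel) = ennreal (gexp_mass TYPE('d) s)"
  using nn_integral_gexp_finite[OF assms, where 'd='d] by (simp add: gexp_mass_def)

text \<open>A strictly positive integrand with zero integral would make \<open>False\<close> hold
  almost everywhere, against the nonzero measure of the whole space.\<close>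

lemma gexp_mass_pos:
  assumes "s > 0"
  shows "gexp_mass TYPE('d::finite) s > 0"
proof -
  have "(\<integral>\<^sup>+x. ennreal (gexp s (x :: real^'d)) \<partial>lborel) \<noteq> 0"
  proof
    assume "(\<integral>\<^sup>+x. ennreal (gexp s (x :: real^'d)) \<partial>lborel) = 0"
    then have "AE x in lborel. ennreal (gexp s (x :: real^'d)) = 0"
      by (subst (asm) nn_integral_0_iff_AE) auto
    then have "AE x in (lborel :: (real^'d) measure). False"
      by (simp add: gexp_def)
    then have "ae_filter (lborel :: (real^'d) measure) = bot"
      by (simp add: trivial_limit_def)
    then show False
      by (simp add: ae_filter_eq_bot_iff emeasure_lborel_UNIV)
  qed
  then show ?thesis
    using nn_integral_gexp[OF assms, where 'd='d] by (metis ennreal_eq_0_iff not_le)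
qed

lemma nn_integral_gexp_shift:
  assumes "s > 0"
  shows "(\<integral>\<^sup>+y. ennreal (gexp s (x - y :: real^'d)) \<partial>lborel) = ennreal (gexp_mass TYPE('d) s)"
proof -
  have "(\<integral>\<^sup>+y. ennreal (gexp s (x - y)) \<partial>lborel) = (\<integral>\<^sup>+y. ennreal (gexp s (y + (- x))) \<partial>lborel)"
    by (simp add: gexp_minus_commute[of s x])
  also have "\<dots> = (\<integral>\<^sup>+y. ennreal (gexp s (y :: real^'d)) \<partial>lborel)"
    by (rule nn_integral_lborel_translate[where f="\<lambda>y. ennreal (gexp s y)"]) measurable
  finally show ?thesis by (simp add: nn_integral_gexp[OF assms])
qed

text \<open>Completing the square around the midpoint \<open>m\<close> of \<open>x\<close> and
  \<open>y\<close> separates the exponent into a part in \<open>x - y\<close>, of width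
  \<open>4 * g\<close>, and a part in \<open>m - z\<close>, of width \<open>g\<close>. Only the
  second is integrated, hence the constant.\<close>

lemma gexp_convolution:
  fixes x y :: "real^'d"
  assumes g: "g > 0"
  shows "(\<integral>\<^sup>+z. ennreal (gexp (2 * g) (x - z)) * ennreal (gexp (2 * g) (z - y)) \<partial>lborel)
    = ennreal (gexp_mass TYPE('d) g) * ennreal (gexp (4 * g) (x - y))"
proof -
  define m where "m = (1/2) *\<^sub>R (x + y)"
  have eq: "gexp (2 * g) (x - z) * gexp (2 * g) (z - y) = gexp (4 * g) (x - y) * gexp g (m - z)" for z
  proof -
    have "(norm (x - z))\<^sup>2 + (norm (z - y))\<^sup>2 = (norm (x - y))\<^sup>2 / 2 + 2 * (norm (m - z))\<^sup>2"
      unfolding power2_norm_eq_inner m_def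
      by (simp add: inner_diff_left inner_diff_right inner_add_left inner_add_right
          inner_commute field_simps)
    then have a: "(norm (x - z))\<^sup>2 = (norm (x - y))\<^sup>2 / 2 + 2 * (norm (m - z))\<^sup>2 - (norm (z - y))\<^sup>2"
      by linarith
    have "- (norm (x - z))\<^sup>2 / (2 * g) + - (norm (z - y))\<^sup>2 / (2 * g)
        = - (norm (x - y))\<^sup>2 / (4 * g) + - (norm (m - z))\<^sup>2 / g"
      unfolding a using g by (simp add: field_simps)
    then show ?thesis unfolding gexp_def mult_exp_exp by simp
  qed
  have "(\<integral>\<^sup>+z. ennreal (gexp (2 * g) (x - z)) * ennreal (gexp (2 * g) (z - y)) \<partial>lborel)
      = (\<integral>\<^sup>+z. ennreal (gexp (4 * g) (x - y)) * ennreal (gexp g (m - z)) \<partial>lborel)"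
    by (intro nn_integral_cong) (simp only: eq gexp_nonneg flip: ennreal_mult)
  also have "\<dots> = ennreal (gexp (4 * g) (x - y)) * (\<integral>\<^sup>+z. ennreal (gexp g (m - z)) \<partial>lborel)"
    by (rule nn_integral_cmult) measurable
  finally show ?thesis by (simp add: nn_integral_gexp_shift[OF g] mult.commute)
qed

section \<open>Smoothed indicators in \<open>ennreal\<close> and the splitting of a Gaussian\<close>

definition nn_conv :: "real \<Rightarrow> (real^'d) set \<Rightarrow> real^'d \<Rightarrow> ennreal" where
  "nn_conv s S x = (\<integral>\<^sup>+y. ennreal (gexp s (x - y)) * indicator S y \<partial>lborel)"

lemma nn_conv_measurable [measurable]:
  assumes [measurable]: "S \<in> sets borel"
  shows "nn_conv s S \<in> borel_measurable borel"
  unfolding nn_conv_def by measurable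

lemma nn_conv_le:
  assumes "s > 0"
  shows "nn_conv s S (x :: real^'d) \<le> ennreal (gexp_mass TYPE('d) s)"
proof -
  have "nn_conv s S x \<le> (\<integral>\<^sup>+y. ennreal (gexp s (x - y)) \<partial>lborel)"
    unfolding nn_conv_def by (rule nn_integral_mono) (simp add: indicator_def)
  then show ?thesis by (simp add: nn_integral_gexp_shift[OF assms])
qed

lemma nn_conv_periodic:
  fixes A :: "real^'d^'d"
  assumes [measurable]: "S \<in> sets borel" and per: "periodic_set A S"
  shows "nn_conv s S (x + lattice_vec A k) = nn_conv s S x"
proof -
  have "nn_conv s S x = (\<integral>\<^sup>+y. ennreal (gexp s (x + lattice_vec A k - (y + lattice_vec A k)))
      * indicator S (y + lattice_vec A k) \<partial>lborel)"
    by (simp add: nn_conv_def indicator_periodic[OF per])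
  also have "\<dots> = nn_conv s S (x + lattice_vec A k)"
    unfolding nn_conv_def by (rule nn_integral_lborel_translate) measurable
  finally show ?thesis by simp
qed

text \<open>Semigroup law and self-adjointness of the heat flow on the torus: half of the smoothing
  of \<open>T\<close> is moved over to \<open>S\<close>. The integrand \<open>?f\<close> is
  invariant under joint lattice shifts because both sets are periodic, which permits the exchange of
  the integration domains.\<close>

lemma nn_pairing:
  fixes A :: "real^'d^'d"
  assumes A: "invertible A" and g: "g > 0"
    and S [measurable]: "S \<in> sets borel" and perS: "periodic_set A S"
    and T [measurable]: "T \<in> sets borel" and perT: "periodic_set A T"
  shows "ennreal (gexp_mass TYPE('d) g) *
      (\<integral>\<^sup>+x. indicator (fund_dom A) x * indicator S x * nn_conv (4 * g) T x \<partial>lborel)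
    = (\<integral>\<^sup>+x. indicator (fund_dom A) x * (nn_conv (2 * g) S x * nn_conv (2 * g) T x) \<partial>lborel)"
proof -
  note [measurable] = fund_dom_borel[OF A]
  let ?F = "indicator (fund_dom A) :: real^'d \<Rightarrow> ennreal" and ?h = "\<lambda>x. ennreal (gexp (2 * g) (x :: real^'d))"
  let ?f = "\<lambda>x z. indicator S x * ?h (x - z) * nn_conv (2 * g) T z"
  have semigroup: "ennreal (gexp_mass TYPE('d) g) * nn_conv (4 * g) T x
      = (\<integral>\<^sup>+z. ?h (x - z) * nn_conv (2 * g) T z \<partial>lborel)" for x
  proof -
    have "ennreal (gexp_mass TYPE('d) g) * nn_conv (4 * g) T x
        = (\<integral>\<^sup>+y. ennreal (gexp_mass TYPE('d) g) * (ennreal (gexp (4 * g) (x - y)) * indicator T y) \<partial>lborel)"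
      unfolding nn_conv_def by (rule nn_integral_cmult[symmetric]) measurable
    also have "\<dots> = (\<integral>\<^sup>+y. (\<integral>\<^sup>+z. ?h (x - z) * ?h (z - y) \<partial>lborel) * indicator T y \<partial>lborel)"
      by (simp add: gexp_convolution[OF g] mult.assoc)
    also have "\<dots> = (\<integral>\<^sup>+y. \<integral>\<^sup>+z. ?h (x - z) * ?h (z - y) * indicator T y \<partial>lborel \<partial>lborel)"
      by (intro nn_integral_cong nn_integral_multc[symmetric]) measurable
    also have "\<dots> = (\<integral>\<^sup>+z. \<integral>\<^sup>+y. ?h (x - z) * ?h (z - y) * indicator T y \<partial>lborel \<partial>lborel)"
      by (rule lborel_pair.Fubini') measurable
    also have "\<dots> = (\<integral>\<^sup>+z. ?h (x - z) * nn_conv (2 * g) T z \<partial>lborel)"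
      unfolding nn_conv_def mult.assoc by (intro nn_integral_cong nn_integral_cmult) measurable
    finally show ?thesis .
  qed
  have "ennreal (gexp_mass TYPE('d) g) * (\<integral>\<^sup>+x. ?F x * indicator S x * nn_conv (4 * g) T x \<partial>lborel)
      = (\<integral>\<^sup>+x. ?F x * (indicator S x * (ennreal (gexp_mass TYPE('d) g) * nn_conv (4 * g) T x)) \<partial>lborel)"
    by (subst nn_integral_cmult[symmetric]) (measurable, simp add: mult_ac)
  also have "\<dots> = (\<integral>\<^sup>+x. ?F x * (\<integral>\<^sup>+z. ?f x z \<partial>lborel) \<partial>lborel)"
    unfolding semigroup mult.assoc
    by (intro nn_integral_cong arg_cong2[where f="(*)"] refl nn_integral_cmult[symmetric]) measurable
  also have "\<dots> = (\<integral>\<^sup>+z. ?F z * (\<integral>\<^sup>+x. ?f x z \<partial>lborel) \<partial>lborel)"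
    by (rule nn_integral_diag_periodic_swap[OF A])
       (measurable, simp add: indicator_periodic[OF perS] nn_conv_periodic[OF T perT])
  also have "\<dots> = (\<integral>\<^sup>+z. ?F z * (nn_conv (2 * g) S z * nn_conv (2 * g) T z) \<partial>lborel)"
  proof (intro nn_integral_cong arg_cong2[where f="(*)"] refl)
    fix z
    have "(\<integral>\<^sup>+x. ?f x z \<partial>lborel) = (\<integral>\<^sup>+x. indicator S x * ?h (x - z) \<partial>lborel) * nn_conv (2 * g) T z"
      by (rule nn_integral_multc) measurable
    then show "(\<integral>\<^sup>+x. ?f x z \<partial>lborel) = nn_conv (2 * g) S z * nn_conv (2 * g) T z"
      by (simp add: nn_conv_def gexp_minus_commute[of _ z] mult.commute)
  qed
  finally show ?thesis .
qed

section \<open>Return to real-valued convolutions\<close>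

lemma conv_ind_cong_AE:
  fixes K :: "real^'d \<Rightarrow> real"
  assumes [measurable]: "K \<in> borel_measurable borel" and "S \<in> sets lebesgue" "S' \<in> sets lebesgue"
    and "AE x in lebesgue. x \<in> S \<longleftrightarrow> x \<in> S'"
  shows "conv_ind K S = conv_ind K S'"
proof
  fix x
  have [measurable]: "(\<lambda>y. K (x - y)) \<in> borel_measurable lebesgue"
    by (rule measurable_completion) simp
  have [measurable]: "S \<in> sets lebesgue" "S' \<in> sets lebesgue" by fact+
  show "conv_ind K S x = conv_ind K S' x"
    unfolding conv_ind_def
    by (rule integral_cong_AE) (measurable, use assms(4) in \<open>auto simp: indicator_def\<close>)
qed

text \<open>The bound by the total mass keeps the value finite, so the passage through
  \<open>enn2real\<close> loses nothing.\<close>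

lemma conv_ind_gexp_eq_nn_conv:
  assumes s: "s > 0" and [measurable]: "S \<in> sets borel"
  shows "ennreal (conv_ind (gexp s) S x) = nn_conv s S x"
proof -
  have "conv_ind (gexp s) S x = (LINT y|lborel. gexp s (x - y) * indicator S y)"
    unfolding conv_ind_def by (rule integral_completion) measurable
  also have "\<dots> = enn2real (\<integral>\<^sup>+y. ennreal (gexp s (x - y) * indicator S y) \<partial>lborel)"
    by (rule integral_eq_nn_integral) (auto simp: gexp_nonneg)
  also have "\<dots> = enn2real (nn_conv s S x)"
    unfolding nn_conv_def
    by (intro arg_cong[where f=enn2real] nn_integral_cong) (simp add: indicator_def)
  also have "ennreal \<dots> = nn_conv s S x"
    using le_less_trans[OF nn_conv_le[OF s, of S x] ennreal_less_top] by simp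
  finally show ?thesis .
qed

lemma conv_ind_gexp_bounds:
  assumes s: "s > 0" and [measurable]: "S \<in> sets borel"
  shows "0 \<le> conv_ind (gexp s) S (x :: real^'d)" "conv_ind (gexp s) S x \<le> gexp_mass TYPE('d) s"
proof -
  show "0 \<le> conv_ind (gexp s) S x"
    unfolding conv_ind_def by (intro integral_nonneg_AE) (simp add: gexp_nonneg)
  then show "conv_ind (gexp s) S x \<le> gexp_mass TYPE('d) s"
    using nn_conv_le[OF s, of S x] gexp_mass_pos[OF s, where 'd='d]
    by (simp flip: conv_ind_gexp_eq_nn_conv[OF assms])
qed

lemma conv_ind_gexp_measurable [measurable]:
  assumes s: "s > 0" and [measurable]: "S \<in> sets borel"
  shows "conv_ind (gexp s) S \<in> borel_measurable borel"
proof -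
  have "conv_ind (gexp s) S x = enn2real (nn_conv s S x)" for x
    using conv_ind_gexp_bounds(1)[OF assms, of x] by (simp flip: conv_ind_gexp_eq_nn_conv[OF assms])
  then have "conv_ind (gexp s) S = (\<lambda>x. enn2real (nn_conv s S x))" by (rule ext)
  then show ?thesis by simp
qed

lemma integrable_on_fund_dom:
  fixes A :: "real^'d^'d"
  assumes A: "invertible A" and [measurable]: "u \<in> borel_measurable borel" and b: "\<And>x. \<bar>u x\<bar> \<le> b"
  shows "integrable lborel (\<lambda>x. indicator (fund_dom A) x * u x :: real)"
proof (rule Bochner_Integration.integrable_bound)
  note [measurable] = fund_dom_borel[OF A]
  show "integrable lborel (\<lambda>x. indicator (fund_dom A) x * b)"
    using fund_dom_finite_measure[of A] by (simp add: integrable_indicator_iff)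
  show "AE x in lborel. norm (indicator (fund_dom A) x * u x) \<le> norm (indicator (fund_dom A) x * b)"
    using b abs_ge_self[of b] order_trans by (fastforce simp: indicator_def)
  show "(\<lambda>x. indicator (fund_dom A) x * u x) \<in> borel_measurable lborel"
    by measurable
qed

lemma pairing_borel:
  fixes A :: "real^'d^'d"
  assumes A: "invertible A" and g: "g > 0"
    and S [measurable]: "S \<in> sets borel" and perS: "periodic_set A S"
    and T [measurable]: "T \<in> sets borel" and perT: "periodic_set A T"
  shows "gexp_mass TYPE('d) g * (LINT x|lborel. indicator (fund_dom A \<inter> S) x * conv_ind (gexp (4 * g)) T x)
    = (LINT x|lborel. indicator (fund_dom A) x * (conv_ind (gexp (2 * g)) S x * conv_ind (gexp (2 * g)) T x))"
proof -
  note [measurable] = fund_dom_borel[OF A]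
  have g': "2 * g > 0" "4 * g > 0" using g by auto
  note [measurable] = conv_ind_gexp_measurable[OF g'(1)] conv_ind_gexp_measurable[OF g'(2)]
  note nn = conv_ind_gexp_eq_nn_conv[OF g'(1)] conv_ind_gexp_eq_nn_conv[OF g'(2)]
  note pos = conv_ind_gexp_bounds(1)[OF g'(1)] conv_ind_gexp_bounds(1)[OF g'(2)]
  have 1: "(LINT x|lborel. indicator (fund_dom A \<inter> S) x * conv_ind (gexp (4 * g)) T x)
      = enn2real (\<integral>\<^sup>+x. indicator (fund_dom A) x * indicator S x * nn_conv (4 * g) T x \<partial>lborel)"
    by (subst integral_eq_nn_integral)
       (auto simp: pos ennreal_mult' indicator_inter_arith nn simp flip: ennreal_indicator
          intro!: arg_cong[where f=enn2real] nn_integral_cong)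
  have 2: "(LINT x|lborel. indicator (fund_dom A) x * (conv_ind (gexp (2 * g)) S x * conv_ind (gexp (2 * g)) T x))
      = enn2real (\<integral>\<^sup>+x. indicator (fund_dom A) x * (nn_conv (2 * g) S x * nn_conv (2 * g) T x) \<partial>lborel)"
    by (subst integral_eq_nn_integral)
       (auto simp: pos ennreal_mult' nn simp flip: ennreal_indicator
          intro!: arg_cong[where f=enn2real] nn_integral_cong)
  \<comment> \<open>\<open>enn2real\<close> is multiplicative on all of \<open>ennreal\<close>, so
    the identity descends to the reals without a finiteness argument.\<close>
  show ?thesis
    unfolding 1 2 nn_pairing[OF assms, symmetric] enn2real_mult
    using gexp_mass_pos[OF g, where 'd='d] by simp
qed

lemma integrable_gexp_indicator:
  fixes x :: "real^'d"
  assumes s: "s > 0" and S: "S \<in> sets lebesgue"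
  shows "integrable lebesgue (\<lambda>y. gexp s (x - y) * indicator S y)"
proof -
  have "integrable lborel (\<lambda>y. gexp s (x - y))"
    using nn_integral_gexp_shift[OF s, of x] gexp_nonneg[of s]
    by (intro integrableI_nonneg) (auto simp: less_top)
  then have "integrable lebesgue (\<lambda>y. gexp s (x - y))"
    by (simp add: integrable_completion)
  from integrable_mult_indicator[OF S this] show ?thesis
    by (simp add: mult.commute)
qed

section \<open>Normalized and scaled Gaussians as they occur in the algorithm\<close>

lemma gauss_eq_gexp:
  "gauss g = (\<lambda>x :: real^'d. (4 * pi * g) powr (- real CARD('d) / 2) * gexp (4 * g) x)"
  by (simp add: gauss_def gexp_def fun_eq_iff)

lemma conv_ind_cmult: "conv_ind (\<lambda>x. c * K x) S x = c * conv_ind K S x"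
  by (simp add: conv_ind_def mult.assoc)

lemma conv_ind_gauss:
  "conv_ind (gauss g) S (x :: real^'d)
    = (4 * pi * g) powr (- real CARD('d) / 2) * conv_ind (gexp (4 * g)) S x"
  unfolding gauss_eq_gexp conv_ind_cmult ..

text \<open>Parabolic scaling: rescaling lengths by \<open>sqrt dt\<close> multiplies the diffusion
  time \<open>g\<close> by \<open>dt\<close>. This matches the kernels of the energy with those
  inside \<open>psi\<close>.\<close>

lemma kernel_scale_gauss:
  assumes "dt > 0" "g > 0"
  shows "kernel_scale (sqrt dt) (gauss g) = (gauss (g * dt) :: real^'d \<Rightarrow> real)"
proof
  fix x :: "real^'d"
  have "(4 * pi * (g * dt)) powr (- real CARD('d) / 2)
      = (4 * pi * g) powr (- real CARD('d) / 2) * dt powr (- real CARD('d) / 2)"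
    using assms powr_mult[of "4 * pi * g" dt] by (simp add: mult.assoc)
  moreover have "sqrt dt powr (- real CARD('d)) = dt powr (- real CARD('d) / 2)"
    using assms by (simp add: powr_half_sqrt[symmetric] powr_powr)
  moreover have "(norm ((1 / sqrt dt) *\<^sub>R x))\<^sup>2 / (4 * g) = (norm x)\<^sup>2 / (4 * (g * dt))"
    using assms by (simp add: power_divide power_mult_distrib)
  ultimately show "kernel_scale (sqrt dt) (gauss g) x = gauss (g * dt) x"
    by (simp add: kernel_scale_def gauss_def)
qed

lemma conv_ind_kernel_K:
  fixes x :: "real^'d"
  assumes dt: "dt > 0" and ab: "\<alpha> > 0" "\<beta> > 0" and S: "S \<in> sets lebesgue"
  shows "conv_ind (kernel_scale (sqrt dt) (kernel_K \<alpha> \<beta> \<sigma> \<mu> i j)) S x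
    = a_coef \<alpha> \<beta> (\<sigma> i j) (\<mu> i j) * conv_ind (gauss (\<alpha> * dt)) S x
    + b_coef \<alpha> \<beta> (\<sigma> i j) (\<mu> i j) * conv_ind (gauss (\<beta> * dt)) S x"
proof -
  let ?a = "a_coef \<alpha> \<beta> (\<sigma> i j) (\<mu> i j)" and ?b = "b_coef \<alpha> \<beta> (\<sigma> i j) (\<mu> i j)"
  have K: "kernel_scale (sqrt dt) (kernel_K \<alpha> \<beta> \<sigma> \<mu> i j) z
      = ?a * gauss (\<alpha> * dt) z + ?b * gauss (\<beta> * dt) z" for z :: "real^'d"
    unfolding kernel_scale_gauss[OF dt ab(1), symmetric] kernel_scale_gauss[OF dt ab(2), symmetric]
    by (simp add: kernel_scale_def kernel_K_def algebra_simps)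
  have int: "integrable lebesgue (\<lambda>y. gauss (g * dt) (x - y) * indicator S y)" if "g > 0" for g
    using integrable_gexp_indicator[OF _ S, of "4 * (g * dt)" x] that dt
    unfolding gauss_eq_gexp by (simp add: mult.assoc)
  have "conv_ind (kernel_scale (sqrt dt) (kernel_K \<alpha> \<beta> \<sigma> \<mu> i j)) S x
      = (LINT y|lebesgue. ?a * (gauss (\<alpha> * dt) (x - y) * indicator S y)
          + ?b * (gauss (\<beta> * dt) (x - y) * indicator S y))"
    unfolding conv_ind_def K by (simp add: distrib_right mult.assoc)
  also have "\<dots> = ?a * conv_ind (gauss (\<alpha> * dt)) S x + ?b * conv_ind (gauss (\<beta> * dt)) S x"
    unfolding conv_ind_def using int ab by simp
  finally show ?thesis .
qed

section \<open>Gaussian pairings of Lebesgue measurable phases\<close>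

lemma conv_ind_gexp_lebesgue:
  assumes s: "s > 0" and S: "S \<in> sets lebesgue"
  shows "conv_ind (gexp s) S \<in> borel_measurable borel"
    and "0 \<le> conv_ind (gexp s) S (x :: real^'d)" "conv_ind (gexp s) S x \<le> gexp_mass TYPE('d) s"
proof -
  obtain C M N where C: "S = C \<union> M" "M \<subseteq> N" "N \<in> null_sets lborel" "C \<in> sets lborel"
    using sets_completionE[OF S] by metis
  have "AE x in lebesgue. x \<in> S \<longleftrightarrow> x \<in> C"
    by (rule AE_I'[OF null_sets_completionI[OF C(3)]]) (use C in auto)
  then have eq: "conv_ind (gexp s) S = conv_ind (gexp s) C"
    using C S by (intro conv_ind_cong_AE) auto
  show "conv_ind (gexp s) S \<in> borel_measurable borel"
    and "0 \<le> conv_ind (gexp s) S x" "conv_ind (gexp s) S x \<le> gexp_mass TYPE('d) s"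
    unfolding eq using C(4) conv_ind_gexp_measurable[OF s] conv_ind_gexp_bounds[OF s] by auto
qed

text \<open>For periodic sets this is the \<open>L^2\<close> inner product on the torus of the
  indicator of \<open>S\<close> with the heat flow at time \<open>g\<close> of the indicator of
  \<open>T\<close>: the first set is cut to one cell, the second is smoothed over the whole
  space.\<close>

definition gauss_pairing :: "real^'d^'d \<Rightarrow> real \<Rightarrow> (real^'d) set \<Rightarrow> (real^'d) set \<Rightarrow> real" where
  "gauss_pairing A g S T = (LINT x|lebesgue. indicator (fund_dom A \<inter> S) x * conv_ind (gauss g) T x)"

lemma gauss_pairing_integrable:
  fixes A :: "real^'d^'d"
  assumes A: "invertible A" and g: "g > 0" and S: "S \<in> sets lebesgue" and T: "T \<in> sets lebesgue"
  shows "integrable lebesgue (\<lambda>x. indicator (fund_dom A \<inter> S) x * conv_ind (gauss g) T x)"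
proof -
  have g': "4 * g > 0" using g by simp
  have "integrable lborel (\<lambda>x. indicator (fund_dom A) x * conv_ind (gexp (4 * g)) T x)"
    using conv_ind_gexp_lebesgue[OF g' T]
    by (intro integrable_on_fund_dom[OF A, where b="gexp_mass TYPE('d) (4 * g)"]) auto
  then have "integrable lebesgue (\<lambda>x. indicator (fund_dom A) x * conv_ind (gexp (4 * g)) T x)"
    by (simp add: integrable_completion)
  from integrable_mult_indicator[OF S this]
  have "integrable lebesgue (\<lambda>x. indicator (fund_dom A \<inter> S) x * conv_ind (gexp (4 * g)) T x)"
    by (simp add: indicator_inter_arith mult_ac)
  then show ?thesis
    unfolding conv_ind_gauss by (simp add: mult.left_commute[of "indicator _ _"])
qed

text \<open>An inner product of smoothed indicators makes the symmetry in \<open>S\<close> and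
  \<open>T\<close> visible and lets sums over pairs of phases be treated pointwise under one
  integral. The positive factor is the normalization of \<open>gauss g\<close> divided by the mass
  left over from convolving two half Gaussians.\<close>

lemma gauss_pairing_factorization:
  fixes A :: "real^'d^'d"
  assumes A: "invertible A" and g: "g > 0"
    and S: "S \<in> sets lebesgue" "periodic_set A S" and T: "T \<in> sets lebesgue" "periodic_set A T"
  shows "gauss_pairing A g S T = (4 * pi * g) powr (- real CARD('d) / 2) / gexp_mass TYPE('d) g *
    (LINT x|lborel. indicator (fund_dom A) x * (conv_ind (gexp (2 * g)) S x * conv_ind (gexp (2 * g)) T x))"
proof -
  let ?c = "(4 * pi * g) powr (- real CARD('d) / 2)" and ?m = "gexp_mass TYPE('d) g"
  obtain S' where S': "S' \<in> sets borel" "periodic_set A S'" "AE x in lebesgue. x \<in> S \<longleftrightarrow> x \<in> S'"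
    using borel_periodic_representative[OF S] .
  obtain T' where T': "T' \<in> sets borel" "periodic_set A T'" "AE x in lebesgue. x \<in> T \<longleftrightarrow> x \<in> T'"
    using borel_periodic_representative[OF T] .
  have "conv_ind (gexp s) S = conv_ind (gexp s) S'" "conv_ind (gexp s) T = conv_ind (gexp s) T'" for s
    using S T S' T' by (auto intro!: conv_ind_cong_AE)
  note cong = this
  note [measurable] = fund_dom_borel[OF A] S'(1) T'(1)
  have g': "4 * g > 0" using g by simp
  note [measurable] = conv_ind_gexp_measurable[OF g' T'(1)]
  have "gauss_pairing A g S T
      = ?c * (LINT x|lebesgue. indicator (fund_dom A \<inter> S) x * conv_ind (gexp (4 * g)) T x)"
    unfolding gauss_pairing_def conv_ind_gauss by (simp add: mult.left_commute[of "indicator _ _"])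
  also have "(LINT x|lebesgue. indicator (fund_dom A \<inter> S) x * conv_ind (gexp (4 * g)) T x)
      = (LINT x|lebesgue. indicator (fund_dom A \<inter> S') x * conv_ind (gexp (4 * g)) T' x)"
  proof (rule integral_cong_AE)
    have u: "conv_ind (gexp (4 * g)) T' \<in> borel_measurable lebesgue"
      by (rule measurable_completion) simp
    have "fund_dom A \<in> sets lebesgue" using fund_dom_borel[OF A] by simp
    with S(1) show "(\<lambda>x. indicator (fund_dom A \<inter> S) x * conv_ind (gexp (4 * g)) T x) \<in> borel_measurable lebesgue"
      unfolding cong by (intro borel_measurable_times borel_measurable_indicator u) auto
    show "(\<lambda>x. indicator (fund_dom A \<inter> S') x * conv_ind (gexp (4 * g)) T' x) \<in> borel_measurable lebesgue"
      by (rule measurable_completion) simp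
    show "AE x in lebesgue. indicator (fund_dom A \<inter> S) x * conv_ind (gexp (4 * g)) T x
        = indicator (fund_dom A \<inter> S') x * conv_ind (gexp (4 * g)) T' x"
      using S'(3) by eventually_elim (simp add: cong indicator_def)
  qed
  also have "\<dots> = (LINT x|lborel. indicator (fund_dom A \<inter> S') x * conv_ind (gexp (4 * g)) T' x)"
    by (rule integral_completion) measurable
  finally show ?thesis
    using pairing_borel[OF A g S'(1,2) T'(1,2)] gexp_mass_pos[OF g, where 'd='d]
    by (simp add: cong field_simps)
qed

lemma gauss_pairing_commute:
  assumes "invertible A" "g > 0" "S \<in> sets lebesgue" "periodic_set A S" "T \<in> sets lebesgue" "periodic_set A T"
  shows "gauss_pairing A g S T = gauss_pairing A g T S"
  using assms by (simp add: gauss_pairing_factorization mult.commute)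

text \<open>The right side does not depend on the partition, so the smoothed phases of two
  partitions differ by a vector whose entries add up to zero, at every point
  \<open>x\<close>.\<close>

lemma torus_partition_conv_sum:
  fixes \<Sigma> :: "'g::finite \<Rightarrow> (real^'d) set"
  assumes s: "s > 0" and P: "torus_partition A \<Sigma>"
  shows "(\<Sum>i\<in>UNIV. conv_ind (gexp s) (\<Sigma> i) x) = conv_ind (gexp s) UNIV x"
proof -
  have "(\<Sum>i\<in>UNIV. conv_ind (gexp s) (\<Sigma> i) x)
      = (LINT y|lebesgue. (\<Sum>i\<in>UNIV. gexp s (x - y) * indicator (\<Sigma> i) y))"
    unfolding conv_ind_def
    using P by (intro Bochner_Integration.integral_sum[symmetric] integrable_gexp_indicator[OF s])
      (auto simp: torus_partition_def)
  also have "\<dots> = (LINT y|lebesgue. gexp s (x - y) * indicator UNIV y)"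
  proof (rule Bochner_Integration.integral_cong)
    fix y
    have "(\<Sum>i\<in>UNIV. indicator (\<Sigma> i) y :: real) = indicator (\<Union>i\<in>UNIV. \<Sigma> i) y"
      using P by (intro indicator_UN_disjoint[symmetric])
        (auto simp: torus_partition_def disjoint_family_on_def)
    then show "(\<Sum>i\<in>UNIV. gexp s (x - y) * indicator (\<Sigma> i) y) = gexp s (x - y) * indicator UNIV y"
      using P by (simp add: torus_partition_def flip: sum_distrib_left)
  qed simp
  finally show ?thesis by (simp add: conv_ind_def)
qed

text \<open>The quadratic form of the energy on the difference of the indicators of two partitions,
  expanded because \<^const>\<open>gauss_pairing\<close> only takes sets.\<close>
lemma gauss_pairing_conditionally_negative:
  fixes \<Sigma> \<Sigma>' :: "'g::finite \<Rightarrow> (real^'d) set" and c :: "'g \<Rightarrow> 'g \<Rightarrow> real"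
  assumes A: "invertible A" and g: "g > 0" and P: "torus_partition A \<Sigma>" and P': "torus_partition A \<Sigma>'"
    and neg: "\<And>v. (\<Sum>i\<in>UNIV. v i) = 0 \<Longrightarrow> (\<Sum>i\<in>UNIV. \<Sum>j\<in>UNIV - {i}. c i j * v i * v j) \<le> 0"
  shows "(\<Sum>i\<in>UNIV. \<Sum>j\<in>UNIV - {i}. c i j * (gauss_pairing A g (\<Sigma>' i) (\<Sigma>' j)
      - gauss_pairing A g (\<Sigma>' i) (\<Sigma> j) - gauss_pairing A g (\<Sigma> i) (\<Sigma>' j)
      + gauss_pairing A g (\<Sigma> i) (\<Sigma> j))) \<le> 0"
proof -
  have leb: "\<Sigma> i \<in> sets lebesgue" "periodic_set A (\<Sigma> i)" "\<Sigma>' i \<in> sets lebesgue" "periodic_set A (\<Sigma>' i)" for i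
    using P P' by (auto simp: torus_partition_def)
  define \<kappa> where "\<kappa> = (4 * pi * g) powr (- real CARD('d) / 2) / gexp_mass TYPE('d) g"
  have \<kappa>: "\<kappa> > 0" using g gexp_mass_pos[OF g, where 'd='d] by (simp add: \<kappa>_def)
  note fac = gauss_pairing_factorization[OF A g, folded \<kappa>_def]
  have g': "2 * g > 0" using g by simp
  let ?F = "indicator (fund_dom A) :: real^'d \<Rightarrow> real" and ?q = "\<lambda>S x. conv_ind (gexp (2 * g)) S x"
  define w where "w i x = ?q (\<Sigma>' i) x - ?q (\<Sigma> i) x" for i x
  have int: "integrable lborel (\<lambda>x. ?F x * (?q S x * ?q T x))"
    if "S \<in> sets lebesgue" "T \<in> sets lebesgue" for S T
    using conv_ind_gexp_lebesgue[OF g' that(1)] conv_ind_gexp_lebesgue[OF g' that(2)]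
    by (intro integrable_on_fund_dom[OF A, where b="gexp_mass TYPE('d) (2 * g) * gexp_mass TYPE('d) (2 * g)"])
       (auto simp: abs_mult less_imp_le[OF gexp_mass_pos[OF g']] intro!: mult_mono borel_measurable_times)
  have prod: "gauss_pairing A g (\<Sigma>' i) (\<Sigma>' j) - gauss_pairing A g (\<Sigma>' i) (\<Sigma> j)
      - gauss_pairing A g (\<Sigma> i) (\<Sigma>' j) + gauss_pairing A g (\<Sigma> i) (\<Sigma> j)
      = \<kappa> * (LINT x|lborel. ?F x * (w i x * w j x))" for i j
  proof -
    have "(LINT x|lborel. ?F x * (w i x * w j x)) = (LINT x|lborel. ?F x * (?q (\<Sigma>' i) x * ?q (\<Sigma>' j) x)
        - ?F x * (?q (\<Sigma>' i) x * ?q (\<Sigma> j) x) - ?F x * (?q (\<Sigma> i) x * ?q (\<Sigma>' j) x)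
        + ?F x * (?q (\<Sigma> i) x * ?q (\<Sigma> j) x))"
      by (rule Bochner_Integration.integral_cong) (auto simp: w_def algebra_simps)
    also have "\<dots> = (LINT x|lborel. ?F x * (?q (\<Sigma>' i) x * ?q (\<Sigma>' j) x))
        - (LINT x|lborel. ?F x * (?q (\<Sigma>' i) x * ?q (\<Sigma> j) x))
        - (LINT x|lborel. ?F x * (?q (\<Sigma> i) x * ?q (\<Sigma>' j) x))
        + (LINT x|lborel. ?F x * (?q (\<Sigma> i) x * ?q (\<Sigma> j) x))"
      using leb by (simp add: int)
    finally have eq: "(LINT x|lborel. ?F x * (w i x * w j x)) = \<dots>" .
    show ?thesis unfolding eq by (simp add: fac leb right_diff_distrib distrib_left)
  qed
  have intw: "integrable lborel (\<lambda>x. ?F x * (w i x * w j x))" for i j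
  proof -
    have "(\<lambda>x. ?F x * (w i x * w j x)) = (\<lambda>x. ?F x * (?q (\<Sigma>' i) x * ?q (\<Sigma>' j) x)
        - ?F x * (?q (\<Sigma>' i) x * ?q (\<Sigma> j) x) - ?F x * (?q (\<Sigma> i) x * ?q (\<Sigma>' j) x)
        + ?F x * (?q (\<Sigma> i) x * ?q (\<Sigma> j) x))"
      by (auto simp: w_def algebra_simps)
    then show ?thesis using leb by (simp add: int)
  qed
  have "(\<Sum>i\<in>UNIV. \<Sum>j\<in>UNIV - {i}. c i j * (\<kappa> * (LINT x|lborel. ?F x * (w i x * w j x))))
      = \<kappa> * (LINT x|lborel. (\<Sum>i\<in>UNIV. \<Sum>j\<in>UNIV - {i}. c i j * (?F x * (w i x * w j x))))"
    by (simp add: Bochner_Integration.integral_sum intw)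
       (simp add: sum_distrib_left mult.left_commute[of \<kappa>])
  also have "(LINT x|lborel. (\<Sum>i\<in>UNIV. \<Sum>j\<in>UNIV - {i}. c i j * (?F x * (w i x * w j x)))) \<le> 0"
  proof -
    have "(\<Sum>i\<in>UNIV. \<Sum>j\<in>UNIV - {i}. c i j * (?F x * (w i x * w j x))) \<le> 0" for x
    proof -
      have "(\<Sum>i\<in>UNIV. w i x) = 0"
        by (simp add: w_def sum_subtractf torus_partition_conv_sum[OF g' P] torus_partition_conv_sum[OF g' P'])
      \<comment> \<open>The matrix hypothesis is used separately at each point, with
        \<open>v i = w i x\<close>; the weight \<open>?F x\<close> is nonnegative.\<close>
      from neg[OF this] have "?F x * (\<Sum>i\<in>UNIV. \<Sum>j\<in>UNIV - {i}. c i j * w i x * w j x) \<le> 0"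
        by (simp add: mult_nonneg_nonpos)
      then show ?thesis
        by (simp add: sum_distrib_left mult_ac)
    qed
    then have "0 \<le> (LINT x|lborel. - (\<Sum>i\<in>UNIV. \<Sum>j\<in>UNIV - {i}. c i j * (?F x * (w i x * w j x))))"
      by (intro Bochner_Integration.integral_nonneg) simp
    then show ?thesis by simp
  qed
  finally show ?thesis using \<kappa> unfolding prod by (simp add: mult_nonneg_nonpos)
qed

subsection \<open>The energy and its linearization\<close>

definition linearized_energy where
  "linearized_energy A \<alpha> \<beta> \<sigma> \<mu> dt \<Sigma>' \<Sigma> = (\<Sum>i\<in>UNIV. \<Sum>j\<in>UNIV - {i}.
      a_coef \<alpha> \<beta> (\<sigma> i j) (\<mu> i j) * gauss_pairing A (\<alpha> * dt) (\<Sigma>' i) (\<Sigma> j)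
    + b_coef \<alpha> \<beta> (\<sigma> i j) (\<mu> i j) * gauss_pairing A (\<beta> * dt) (\<Sigma>' i) (\<Sigma> j))"

text \<open>Collecting the terms of each candidate phase under one integral turns minimization over
  partitions into a pointwise choice of the label with the least \<open>psi\<close>.\<close>

lemma linearized_energy_eq_psi:
  fixes \<Sigma> \<Sigma>' :: "'g::finite \<Rightarrow> (real^'d) set"
  assumes A: "invertible A" and dt: "dt > 0" and ab: "\<alpha> > 0" "\<beta> > 0"
    and P: "torus_partition A \<Sigma>" and P': "torus_partition A \<Sigma>'"
  shows "integrable lebesgue (\<lambda>x. \<Sum>i\<in>UNIV. indicator (fund_dom A \<inter> \<Sigma>' i) x * psi \<alpha> \<beta> \<sigma> \<mu> dt \<Sigma> i x)"
    and "linearized_energy A \<alpha> \<beta> \<sigma> \<mu> dt \<Sigma>' \<Sigma>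
      = (LINT x|lebesgue. (\<Sum>i\<in>UNIV. indicator (fund_dom A \<inter> \<Sigma>' i) x * psi \<alpha> \<beta> \<sigma> \<mu> dt \<Sigma> i x))"
proof -
  let ?a = "\<lambda>i j. a_coef \<alpha> \<beta> (\<sigma> i j) (\<mu> i j)" and ?b = "\<lambda>i j. b_coef \<alpha> \<beta> (\<sigma> i j) (\<mu> i j)"
  let ?p = "\<lambda>g i j x. indicator (fund_dom A \<inter> \<Sigma>' i) x * conv_ind (gauss (g * dt)) (\<Sigma> j) x"
  have int: "integrable lebesgue (?p g i j)" if "g > 0" for g i j
    using P P' that dt by (intro gauss_pairing_integrable[OF A]) (auto simp: torus_partition_def)
  have eq: "(\<Sum>i\<in>UNIV. indicator (fund_dom A \<inter> \<Sigma>' i) x * psi \<alpha> \<beta> \<sigma> \<mu> dt \<Sigma> i x)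
      = (\<Sum>i\<in>UNIV. \<Sum>j\<in>UNIV - {i}. ?a i j * ?p \<alpha> i j x + ?b i j * ?p \<beta> i j x)" for x
    unfolding psi_def sum_distrib_left by (simp add: algebra_simps)
  show "integrable lebesgue (\<lambda>x. \<Sum>i\<in>UNIV. indicator (fund_dom A \<inter> \<Sigma>' i) x * psi \<alpha> \<beta> \<sigma> \<mu> dt \<Sigma> i x)"
    unfolding eq using int ab by (intro Bochner_Integration.integrable_sum
        Bochner_Integration.integrable_add integrable_mult_right) auto
  show "linearized_energy A \<alpha> \<beta> \<sigma> \<mu> dt \<Sigma>' \<Sigma>
      = (LINT x|lebesgue. (\<Sum>i\<in>UNIV. indicator (fund_dom A \<inter> \<Sigma>' i) x * psi \<alpha> \<beta> \<sigma> \<mu> dt \<Sigma> i x))"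
    unfolding eq linearized_energy_def gauss_pairing_def
    using int ab by (simp add: Bochner_Integration.integral_sum)
qed

lemma energy_eq_linearized:
  fixes \<Sigma> :: "'g::finite \<Rightarrow> (real^'d) set"
  assumes A: "invertible A" and dt: "dt > 0" and ab: "\<alpha> > 0" "\<beta> > 0" and P: "torus_partition A \<Sigma>"
    and sym: "\<And>i j. \<sigma> i j = \<sigma> j i" "\<And>i j. \<mu> i j = \<mu> j i"
  shows "energy A \<alpha> \<beta> \<sigma> \<mu> dt \<Sigma> = 1 / sqrt dt * linearized_energy A \<alpha> \<beta> \<sigma> \<mu> dt \<Sigma> \<Sigma>"
proof -
  have leb: "\<Sigma> i \<in> sets lebesgue" "periodic_set A (\<Sigma> i)" for i
    using P by (auto simp: torus_partition_def)
  have pos: "\<alpha> * dt > 0" "\<beta> * dt > 0" using ab dt by auto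
  have "(LINT x|lebesgue. indicator (fund_dom A \<inter> \<Sigma> j) x *
           conv_ind (kernel_scale (sqrt dt) (kernel_K \<alpha> \<beta> \<sigma> \<mu> i j)) (\<Sigma> i) x)
      = a_coef \<alpha> \<beta> (\<sigma> i j) (\<mu> i j) * gauss_pairing A (\<alpha> * dt) (\<Sigma> i) (\<Sigma> j)
      + b_coef \<alpha> \<beta> (\<sigma> i j) (\<mu> i j) * gauss_pairing A (\<beta> * dt) (\<Sigma> i) (\<Sigma> j)" (is "?L = ?R") for i j
  proof -
    let ?a = "a_coef \<alpha> \<beta> (\<sigma> i j) (\<mu> i j)" and ?b = "b_coef \<alpha> \<beta> (\<sigma> i j) (\<mu> i j)"
    have "?L = (LINT x|lebesgue. ?a * (indicator (fund_dom A \<inter> \<Sigma> j) x * conv_ind (gauss (\<alpha> * dt)) (\<Sigma> i) x)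
        + ?b * (indicator (fund_dom A \<inter> \<Sigma> j) x * conv_ind (gauss (\<beta> * dt)) (\<Sigma> i) x))"
      by (simp add: conv_ind_kernel_K[OF dt ab leb(1)] distrib_left mult.left_commute)
    also have "\<dots> = ?a * gauss_pairing A (\<alpha> * dt) (\<Sigma> j) (\<Sigma> i) + ?b * gauss_pairing A (\<beta> * dt) (\<Sigma> j) (\<Sigma> i)"
      unfolding gauss_pairing_def
      using gauss_pairing_integrable[OF A pos(1) leb(1)[of j] leb(1)[of i]]
        gauss_pairing_integrable[OF A pos(2) leb(1)[of j] leb(1)[of i]] by simp
    \<comment> \<open>The energy integrates phase \<open>j\<close> and smooths phase
      \<open>i\<close>, the linearization does the opposite; symmetry of the Gaussian pairing
      reconciles them.\<close>
    finally show ?thesis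
      by (simp add: gauss_pairing_commute[OF A pos(1) leb leb, of j i] gauss_pairing_commute[OF A pos(2) leb leb, of j i])
  qed
  then show ?thesis by (simp add: energy_def linearized_energy_def)
qed

text \<open>At each point of the cell exactly one phase contributes its \<open>psi\<close>, and the
  new label has the least one. \<open>alg4_step\<close> asks for some minimizing label, so any rule
  for ties that yields a partition of the torus is covered.\<close>

lemma linearized_energy_le:
  fixes \<Sigma> \<Sigma>' :: "'g::finite \<Rightarrow> (real^'d) set"
  assumes A: "invertible A" and dt: "dt > 0" and ab: "\<alpha> > 0" "\<beta> > 0"
    and P: "torus_partition A \<Sigma>" and step: "alg4_step A \<alpha> \<beta> \<sigma> \<mu> dt \<Sigma> \<Sigma>'"
  shows "linearized_energy A \<alpha> \<beta> \<sigma> \<mu> dt \<Sigma>' \<Sigma> \<le> linearized_energy A \<alpha> \<beta> \<sigma> \<mu> dt \<Sigma> \<Sigma>"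
proof -
  have P': "torus_partition A \<Sigma>'" using step by (simp add: alg4_step_def)
  let ?\<psi> = "\<lambda>i x. psi \<alpha> \<beta> \<sigma> \<mu> dt \<Sigma> i x"
  have pick: "(\<Sum>i\<in>UNIV. indicator (fund_dom A \<inter> \<Omega> i) x * ?\<psi> i x) = indicator (fund_dom A) x * ?\<psi> k x"
    if "torus_partition A \<Omega>" "x \<in> \<Omega> k" for \<Omega> x k
  proof -
    have "indicator (fund_dom A \<inter> \<Omega> i) x * ?\<psi> i x
        = (if k = i then indicator (fund_dom A) x * ?\<psi> i x else 0)" for i
      using that by (auto simp: torus_partition_def indicator_def)
    then show ?thesis by simp
  qed
  have "(\<Sum>i\<in>UNIV. indicator (fund_dom A \<inter> \<Sigma>' i) x * ?\<psi> i x)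
      \<le> (\<Sum>i\<in>UNIV. indicator (fund_dom A \<inter> \<Sigma> i) x * ?\<psi> i x)" for x
  proof -
    obtain k where k: "x \<in> \<Sigma> k" using P unfolding torus_partition_def by blast
    obtain k' where k': "x \<in> \<Sigma>' k'" using P' unfolding torus_partition_def by blast
    have "?\<psi> k' x \<le> ?\<psi> k x" using step k' by (auto simp: alg4_step_def)
    then show ?thesis
      unfolding pick[OF P k] pick[OF P' k'] by (simp add: mult_left_mono)
  qed
  then show ?thesis
    unfolding linearized_energy_eq_psi(2)[OF A dt ab P P'] linearized_energy_eq_psi(2)[OF A dt ab P P]
    by (intro integral_mono linearized_energy_eq_psi(1)[OF A dt ab P P']
        linearized_energy_eq_psi(1)[OF A dt ab P P])
qed

lemma linearized_energy_commute:
  fixes \<Sigma> \<Sigma>' :: "'g::finite \<Rightarrow> (real^'d) set"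
  assumes A: "invertible A" and dt: "dt > 0" and ab: "\<alpha> > 0" "\<beta> > 0"
    and P: "torus_partition A \<Sigma>" and P': "torus_partition A \<Sigma>'"
    and sym: "\<And>i j. \<sigma> i j = \<sigma> j i" "\<And>i j. \<mu> i j = \<mu> j i"
  shows "linearized_energy A \<alpha> \<beta> \<sigma> \<mu> dt \<Sigma>' \<Sigma> = linearized_energy A \<alpha> \<beta> \<sigma> \<mu> dt \<Sigma> \<Sigma>'"
proof -
  have leb: "\<Sigma> i \<in> sets lebesgue" "periodic_set A (\<Sigma> i)" "\<Sigma>' i \<in> sets lebesgue" "periodic_set A (\<Sigma>' i)" for i
    using P P' by (auto simp: torus_partition_def)
  have pos: "\<alpha> * dt > 0" "\<beta> * dt > 0" using ab dt by auto
  define t where "t i j = a_coef \<alpha> \<beta> (\<sigma> i j) (\<mu> i j) * gauss_pairing A (\<alpha> * dt) (\<Sigma>' i) (\<Sigma> j)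
    + b_coef \<alpha> \<beta> (\<sigma> i j) (\<mu> i j) * gauss_pairing A (\<beta> * dt) (\<Sigma>' i) (\<Sigma> j)" for i j
  \<comment> \<open>Zeros on the diagonal make the inner index set independent of \<open>i\<close>,
    so that the two sums can be swapped.\<close>
  have off: "(\<Sum>i\<in>UNIV. \<Sum>j\<in>UNIV - {i}. u i j) = (\<Sum>i\<in>UNIV. \<Sum>j\<in>UNIV. if i = j then 0 else u i j)"
    for u :: "'g \<Rightarrow> 'g \<Rightarrow> real"
    by (intro sum.cong refl sum.mono_neutral_cong_left) auto
  have "linearized_energy A \<alpha> \<beta> \<sigma> \<mu> dt \<Sigma>' \<Sigma> = (\<Sum>i\<in>UNIV. \<Sum>j\<in>UNIV - {i}. t i j)"
    by (simp add: linearized_energy_def t_def)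
  also have "\<dots> = (\<Sum>i\<in>UNIV. \<Sum>j\<in>UNIV - {i}. t j i)"
    unfolding off by (subst sum.swap) (simp add: eq_commute)
  also have "\<dots> = linearized_energy A \<alpha> \<beta> \<sigma> \<mu> dt \<Sigma> \<Sigma>'"
    unfolding linearized_energy_def t_def
    by (intro sum.cong refl arg_cong2[where f="(+)"] arg_cong2[where f="(*)"] gauss_pairing_commute A pos leb)
       (simp_all only: sym(1)[of _ i for i] sym)
  finally show ?thesis .
qed

text \<open>This is nonpositivity of the form at the difference of the two indicator vectors,
  expanded by bilinearity. The two Gaussians contribute separately, each with its own coefficient
  matrix, hence the two sign conditions.\<close>

lemma linearized_energy_midpoint_concave:
  fixes \<Sigma> \<Sigma>' :: "'g::finite \<Rightarrow> (real^'d) set"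
  assumes A: "invertible A" and dt: "dt > 0" and ab: "\<alpha> > 0" "\<beta> > 0"
    and P: "torus_partition A \<Sigma>" and P': "torus_partition A \<Sigma>'"
    and neg_a: "\<And>v. (\<Sum>i\<in>UNIV. v i) = 0 \<Longrightarrow>
      (\<Sum>i\<in>UNIV. \<Sum>j\<in>UNIV - {i}. a_coef \<alpha> \<beta> (\<sigma> i j) (\<mu> i j) * v i * v j) \<le> 0"
    and neg_b: "\<And>v. (\<Sum>i\<in>UNIV. v i) = 0 \<Longrightarrow>
      (\<Sum>i\<in>UNIV. \<Sum>j\<in>UNIV - {i}. b_coef \<alpha> \<beta> (\<sigma> i j) (\<mu> i j) * v i * v j) \<le> 0"
  shows "linearized_energy A \<alpha> \<beta> \<sigma> \<mu> dt \<Sigma>' \<Sigma>' + linearized_energy A \<alpha> \<beta> \<sigma> \<mu> dt \<Sigma> \<Sigma>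
    \<le> linearized_energy A \<alpha> \<beta> \<sigma> \<mu> dt \<Sigma>' \<Sigma> + linearized_energy A \<alpha> \<beta> \<sigma> \<mu> dt \<Sigma> \<Sigma>'"
proof -
  have pos: "\<alpha> * dt > 0" "\<beta> * dt > 0" using ab dt by auto
  show ?thesis
    using gauss_pairing_conditionally_negative[OF A pos(1) P P' neg_a]
      gauss_pairing_conditionally_negative[OF A pos(2) P P' neg_b]
    unfolding linearized_energy_def
    by (simp add: distrib_left right_diff_distrib sum.distrib sum_subtractf)
qed

theorem theorem4p5:
  fixes \<sigma> :: "'g::finite \<Rightarrow> 'g \<Rightarrow> real"
    and A :: "real^'d::finite^'d"
    and \<alpha> \<beta> dt :: real
    and \<Sigma> :: "nat \<Rightarrow> 'g \<Rightarrow> (real^'d) set"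
  assumes N: "CARD('g) \<ge> 2"
    and model: "(CARD('d) = 2 \<and>
                  (\<exists>f \<theta>. rs2_admissible f \<and> rs2_orientations \<theta> \<and> \<sigma> = rs2_sigma f \<theta>))
              \<or> (CARD('d) = 3 \<and>
                  (\<exists>\<theta>s g. 0 < \<theta>s \<and> \<theta>s \<le> pi / 4 \<and> rs3_orientations g \<and> \<sigma> = rs3_sigma \<theta>s g))"
    and torus: "invertible A"
    and ab: "\<alpha> > \<beta>" "\<beta> > 0"
    and alpha_max: "\<forall>i j. i \<noteq> j \<longrightarrow> \<sigma> i j \<le> \<alpha>"
    and beta_min: "\<forall>i j. i \<noteq> j \<longrightarrow> \<beta> \<le> \<sigma> i j"
    and alpha_eig: "\<alpha> \<ge> Min (eigs_perp (J_mat ** tension_mat \<sigma> ** J_mat))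
                         / Max (eigs_perp (J_mat ** recip_mob_mat (\<lambda>i j. 1) ** J_mat :: real^'g^'g))"
    and beta_eig: "\<beta> \<le> Max (eigs_perp (J_mat ** tension_mat \<sigma> ** J_mat))
                         / Min (eigs_perp (J_mat ** recip_mob_mat (\<lambda>i j. 1) ** J_mat :: real^'g^'g))"
    and dt: "dt > 0"
    and init: "torus_partition A (\<Sigma> 0)"
    and iter: "\<forall>k. alg4_step A \<alpha> \<beta> \<sigma> (\<lambda>i j. 1) dt (\<Sigma> k) (\<Sigma> (Suc k))"
  shows "\<forall>k. energy A \<alpha> \<beta> \<sigma> (\<lambda>i j. 1) dt (\<Sigma> (Suc k))
            \<le> energy A \<alpha> \<beta> \<sigma> (\<lambda>i j. 1) dt (\<Sigma> k)"
proof
  fix k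
  have sym: "\<sigma> i j = \<sigma> j i" for i j
    using model rs2_sigma_commute rs3_sigma_commute by metis
  have pos: "\<alpha> > 0" "\<beta> > 0" using ab by auto
  have P: "torus_partition A (\<Sigma> k)" for k
    using init iter by (cases k) (auto simp: alg4_step_def)
  \<comment> \<open>The denominators in the eigenvalue hypotheses both equal
    \<open>-1\<close>.\<close>
  have alpha: "\<alpha> \<ge> - Min (eigs_perp (J_mat ** tension_mat \<sigma> ** J_mat))"
    and beta: "\<beta> \<le> - Max (eigs_perp (J_mat ** tension_mat \<sigma> ** J_mat))"
    using alpha_eig beta_eig by (simp_all add: eigs_perp_recip_mob[OF N])
  let ?L = "linearized_energy A \<alpha> \<beta> \<sigma> (\<lambda>i j. 1) dt"
  \<comment> \<open>By the two facts that follow, the right side is at most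
    \<open>2 * ?L (\<Sigma> k) (\<Sigma> k)\<close>.\<close>
  have "?L (\<Sigma> (Suc k)) (\<Sigma> (Suc k)) + ?L (\<Sigma> k) (\<Sigma> k) \<le> ?L (\<Sigma> (Suc k)) (\<Sigma> k) + ?L (\<Sigma> k) (\<Sigma> (Suc k))"
    by (rule linearized_energy_midpoint_concave[OF torus dt pos P P
          a_coef_conditionally_negative[OF N sym ab beta] b_coef_conditionally_negative[OF N sym ab alpha]])
  moreover have "?L (\<Sigma> k) (\<Sigma> (Suc k)) = ?L (\<Sigma> (Suc k)) (\<Sigma> k)"
    by (rule linearized_energy_commute[OF torus dt pos P P sym refl])
  moreover have "?L (\<Sigma> (Suc k)) (\<Sigma> k) \<le> ?L (\<Sigma> k) (\<Sigma> k)"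
    using iter by (intro linearized_energy_le[OF torus dt pos P]) auto
  ultimately have "?L (\<Sigma> (Suc k)) (\<Sigma> (Suc k)) \<le> ?L (\<Sigma> k) (\<Sigma> k)"
    by linarith
  then show "energy A \<alpha> \<beta> \<sigma> (\<lambda>i j. 1) dt (\<Sigma> (Suc k)) \<le> energy A \<alpha> \<beta> \<sigma> (\<lambda>i j. 1) dt (\<Sigma> k)"
    using dt by (simp add: energy_eq_linearized[OF torus dt pos P sym refl] divide_right_mono)
qed

end
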